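(* Let $n=kd$ with $k\geq 2$, and let $C_1\subseteq S_n$ be the code constructed in the context. There is a decoding algorithm which, given $\tau\in S_n$ such that $d_\infty(\sigma,\tau)\leq t$ for some $\sigma\in C_1$, where $t\leq\lfloor (d-1)/2\rfloor$, outputs $\hat\sigma\in C_1$ with $d_\infty(\tau,\hat\sigma)\leq t$ (namely $\hat\sigma=\sigma$), and which runs in $O(kd)=O(n)$ steps.
   Context: Simple integer operations are assumed to take constant time. $S_n$ is the group of permutations of $[n]=\{1,\dots,n\}$; vector notation $\sigma=[\sigma(1),\dots,\sigma(n)]$; $d_\infty(\sigma,\tau)=\max_{j}|\sigma(j)-\tau(j)|$. For $1\leq i<j\leq n$, $t_{i\uparrow j}([a_1,\dots,a_n])=[a_1,\dots,a_{i-1},a_j,a_i,\dots,a_{j-1},a_{j+1},\dots,a_n]$, $t_{\uparrow j}=t_{1\uparrow j}$. A $G_{\uparrow}(n,M)$ is a sequence $(c_1,\dots,c_M)$ of pairwise distinct elements of $S_n$ such that for every $r\in[M]$, $c_{(r\bmod M)+1}=t_{\uparrow j_r}(c_r)$ for some $1<j_r\leq n$; the $t_{\uparrow j_r}$ form its transition sequence. A $\mathrm{G}^{\mathrm{aux}}_{\uparrow}(l,M)$ is a $G_\uparrow(l,M)$ code $C$ such that for all $q\in[l-1]$ and $\sigma\in C$, $(q,l)\circ\sigma\notin C$. Auxiliary codes. For each $l\geq3$ an auxiliary $\mathrm{G}^{\mathrm{aux}}_{\uparrow}(l,\tilde M_l)$ code starting at the identity with first transition $t_{\uparrow l}$ is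 fixed (such codes exist), whose underlying set is as follows. For odd $l\neq5$: all even permutations in $S_l$ ($\tilde M_l=l!/2$). For $l=5$: some fixed set of $57$ even permutations. For $l=4$: the $8$ permutations in whose vector notation $1$ cyclically follows $4$. For even $l=2m+2\geq 6$: let $\hat\pi_r=(1,2m+1)^r(2m+2,2m,2m-1,\dots,2)^r$, $\beta_r=t_{\uparrow 2m+2}^{-1}(\hat\pi_r)$, $P_0'=\{t_{\uparrow 2m-1}^{\,q}(\mathrm{Id}):0\le q\le 2m-2\}$, $\tilde\pi=t_{\uparrow 2m-1}^{-1}(\mathrm{Id})$; for $l>6$ let $P_r$ be the set of even $\pi\in S_{2m+2}$ with $\pi(2m+2)=\hat\pi_r(2m+2)$ (for $l=6$, a fixed subset of it of size $57$); the code is the set $\tilde\pi^{-1}\circ\left(P_0'\cup\bigcup_{r=1}^{2m-1}P_r\cup\{\beta_r\}_{r=1}^{2m}\right)$. For each $k$ also fix a complete code $G_\uparrow(k,k!)$ (known to exist). Construction of $C_1$. Codes $C_d,\dots,C_1$ all start at $\sigma_0\in S_n$, $\sigma_0(j)=d\,(j\bmod k)+\lceil j/k\rceil$. If $t_{\uparrow r_1},\dots,t_{\uparrow r_{k!}}$ is the transition sequence of the complete $G_\uparrow(k,k!)$, then $C_d$ has transition sequence $t_{k(d-1)+1\uparrow k(d-1)+r_1},\dots,t_{k(d-1)+1\uparrow k(d-1)+r_{k!}}$. If $t_{\uparrow k+1},t_{\uparrow i_2},\dots,t_{\uparrow i_{\tilde M_{k+1}}}$ is the transition sequence of the auxiliary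 code in $S_{k+1}$, then the transition sequence of $C_m$ is that of $C_{m+1}$ with each $t_{km+1\uparrow j}$ replaced by $t_{k(m-1)+1\uparrow j}$ followed by $t_{k(m-1)+1\uparrow k(m-1)+i_2},\dots,t_{k(m-1)+1\uparrow k(m-1)+i_{\tilde M_{k+1}}}$. The resulting $C_1$ has minimal $d_\infty$-distance at least $d$. *)

theory Defs
  imports Complex_Main "HOL-Combinatorics.Combinatorics"
begin

section \<open>Permutations as vectors, push-to-the-top transitions, Gray codes\<close>

text \<open>
  An element of \<open>S\<^sub>n\<close> is a function on the naturals that permutes \<open>{1..n}\<close> (and hence is
  the identity elsewhere); its vector notation is \<open>[\<sigma> 1, \<dots>, \<sigma> n]\<close>. Products of permutations are
  compositions of functions, applied from right to left.
\<close>

definition sym_grp :: "nat \<Rightarrow> (nat \<Rightarrow> nat) set" where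
  "sym_grp n = {\<sigma>. \<sigma> permutes {1..n}}"

definition d_inf :: "nat \<Rightarrow> (nat \<Rightarrow> nat) \<Rightarrow> (nat \<Rightarrow> nat) \<Rightarrow> int" where
  "d_inf n \<sigma> \<tau> = Max ((\<lambda>j. \<bar>int (\<sigma> j) - int (\<tau> j)\<bar>) ` {1..n})"

definition push_up :: "nat \<Rightarrow> nat \<Rightarrow> (nat \<Rightarrow> nat) \<Rightarrow> (nat \<Rightarrow> nat)" where
  "push_up i j a =
     (\<lambda>p. if p = i then a j else if i < p \<and> p \<le> j then a (p - 1) else a p)"

text \<open>
  Codes and transition sequences are lists, indexed from 0; a transition \<open>t\<^sub>\<up>\<^sub>j\<close> is recorded by
  its index \<open>j\<close>. The index is determined by the two codewords it connects, so a code has at most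
  one transition sequence.
\<close>

definition transition_seq :: "nat \<Rightarrow> (nat \<Rightarrow> nat) list \<Rightarrow> nat list \<Rightarrow> bool" where
  "transition_seq n c js \<longleftrightarrow>
     length js = length c \<and>
     (\<forall>r < length c. 1 < js ! r \<and> js ! r \<le> n \<and>
        c ! ((r + 1) mod length c) = push_up 1 (js ! r) (c ! r))"

definition G_up :: "nat \<Rightarrow> nat \<Rightarrow> (nat \<Rightarrow> nat) list \<Rightarrow> bool" where
  "G_up n M c \<longleftrightarrow>
     length c = M \<and> distinct c \<and> set c \<subseteq> sym_grp n \<and> (\<exists>js. transition_seq n c js)"

definition G_aux :: "nat \<Rightarrow> nat \<Rightarrow> (nat \<Rightarrow> nat) list \<Rightarrow> bool" where
  "G_aux l M c \<longleftrightarrow>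
     G_up l M c \<and> (\<forall>q\<in>{1..l - 1}. \<forall>\<sigma>\<in>set c. transpose q l \<circ> \<sigma> \<notin> set c)"

section \<open>The auxiliary codes\<close>

definition even_perms :: "nat \<Rightarrow> (nat \<Rightarrow> nat) set" where
  "even_perms l = {\<pi> \<in> sym_grp l. evenperm \<pi>}"

definition pi_hat :: "nat \<Rightarrow> nat \<Rightarrow> nat \<Rightarrow> nat" where
  "pi_hat m r =
     (transpose 1 (2*m + 1) ^^ r) \<circ> (cycle_of_list ((2*m + 2) # rev [2..<2*m + 1]) ^^ r)"

definition beta :: "nat \<Rightarrow> nat \<Rightarrow> nat \<Rightarrow> nat" where
  "beta m r = inv (push_up 1 (2*m + 2)) (pi_hat m r)"

definition P0' :: "nat \<Rightarrow> (nat \<Rightarrow> nat) set" where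
  "P0' m = {(push_up 1 (2*m - 1) ^^ q) id | q. q \<le> 2*m - 2}"

definition pi_tilde :: "nat \<Rightarrow> nat \<Rightarrow> nat" where
  "pi_tilde m = inv (push_up 1 (2*m - 1)) id"

definition even_perms_ending :: "nat \<Rightarrow> nat \<Rightarrow> (nat \<Rightarrow> nat) set" where
  "even_perms_ending m r =
     {\<pi> \<in> even_perms (2*m + 2). \<pi> (2*m + 2) = pi_hat m r (2*m + 2)}"

text \<open>
  The set underlying the auxiliary code in \<open>S\<^sub>l\<close>, as a predicate since it is only partly specified
  for \<open>l = 5\<close> and \<open>l = 6\<close> (that is, \<open>m = 2\<close>).
\<close>

definition aux_set_even :: "nat \<Rightarrow> (nat \<Rightarrow> nat) set \<Rightarrow> bool" where
  "aux_set_even m A \<longleftrightarrow>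
     (\<exists>P. (\<forall>r\<in>{1..2*m - 1}.
             if m = 2 then P r \<subseteq> even_perms_ending m r \<and> card (P r) = 57
             else P r = even_perms_ending m r) \<and>
          A = (\<lambda>\<pi>. inv (pi_tilde m) \<circ> \<pi>) `
                (P0' m \<union> (\<Union>r\<in>{1..2*m - 1}. P r) \<union> beta m ` {1..2*m}))"

definition aux_set :: "nat \<Rightarrow> (nat \<Rightarrow> nat) set \<Rightarrow> bool" where
  "aux_set l A \<longleftrightarrow>
     (if l = 5 then A \<subseteq> even_perms 5 \<and> card A = 57
      else if odd l then A = even_perms l
      else if l = 4 then A = {\<pi> \<in> sym_grp 4. \<exists>i\<in>{1..4}. \<pi> i = 4 \<and> \<pi> (i mod 4 + 1) = 1}
      else aux_set_even ((l - 2) div 2) A)"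

definition auxiliary_code :: "nat \<Rightarrow> (nat \<Rightarrow> nat) list \<Rightarrow> nat list \<Rightarrow> bool" where
  "auxiliary_code l c js \<longleftrightarrow>
     G_aux l (length c) c \<and> transition_seq l c js \<and>
     c \<noteq> [] \<and> hd c = id \<and> hd js = l \<and> aux_set l (set c)"

definition complete_code :: "nat \<Rightarrow> (nat \<Rightarrow> nat) list \<Rightarrow> nat list \<Rightarrow> bool" where
  "complete_code k c js \<longleftrightarrow> G_up k (fact k) c \<and> transition_seq k c js"

section \<open>The code \<open>C\<^sub>1\<close>\<close>

definition sigma0 :: "nat \<Rightarrow> nat \<Rightarrow> nat \<Rightarrow> nat" where
  "sigma0 k d j =
     (if j \<in> {1..k*d} then d * (j mod k) + nat \<lceil>real j / real k\<rceil> else j)"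

text \<open>
  Here \<open>rs\<close> is the transition sequence of the complete code in \<open>S\<^sub>k\<close> and \<open>is\<close> that of the
  auxiliary code in \<open>S\<^bsub>k+1\<^esub>\<close>; the pair \<open>(i, j)\<close> stands for the transition \<open>t\<^bsub>i\<up>j\<^esub>\<close>.
  \<open>code_transitions k d rs is m\<close> is the transition sequence of \<open>C\<^sub>m\<close>, for \<open>1 \<le> m \<le> d\<close>.
\<close>

function code_transitions ::
    "nat \<Rightarrow> nat \<Rightarrow> nat list \<Rightarrow> nat list \<Rightarrow> nat \<Rightarrow> (nat \<times> nat) list" where
  "code_transitions k d rs is m =
     (if d \<le> m then map (\<lambda>r. (k*(d - 1) + 1, k*(d - 1) + r)) rs
      else concat (map (\<lambda>(_, j).
             (k*(m - 1) + 1, j) # map (\<lambda>i. (k*(m - 1) + 1, k*(m - 1) + i)) (tl is))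
           (code_transitions k d rs is (m + 1))))"
  by pat_completeness auto
termination by (relation "measure (\<lambda>(k, d, rs, is, m). d - m)") auto

declare code_transitions.simps [simp del]

text \<open>
  The codewords are those left by the successive transitions; the last transition returns to the
  first codeword.
\<close>

fun codewords :: "(nat \<Rightarrow> nat) \<Rightarrow> (nat \<times> nat) list \<Rightarrow> (nat \<Rightarrow> nat) list" where
  "codewords \<sigma> [] = []"
| "codewords \<sigma> ((i, j) # ts) = \<sigma> # codewords (push_up i j \<sigma>) ts"

definition code_C1 :: "nat \<Rightarrow> nat \<Rightarrow> nat list \<Rightarrow> nat list \<Rightarrow> (nat \<Rightarrow> nat) set" where
  "code_C1 k d rs is = set (codewords (sigma0 k d) (code_transitions k d rs is 1))"

section \<open>Algorithms and their running time\<close>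

text \<open>
  Algorithms are programs of a random access machine, presented as a structured language: finitely
  many registers and arrays (numbered by naturals) hold natural numbers. Each integer operation,
  comparison, connective, array access, assignment and branch takes one step. The semantics has a
  word bound \<open>w\<close>: a program gets stuck as soon as a number greater than \<open>w\<close> occurs, so that
  a step never handles more than one machine word. Subtraction is truncated at 0.
\<close>

datatype aexp =
    Lit nat
  | Reg nat
  | Elem nat aexp
  | Add aexp aexp
  | Sub aexp aexp
  | Mul aexp aexp
  | Quot aexp aexp
  | Rem aexp aexp

datatype bexp =
    Less aexp aexp
  | Equal aexp aexp
  | Neg bexp
  | Conj bexp bexp
  | Disj bexp bexp

datatype com =
    Skip
  | Assign nat aexp
  | Store nat aexp aexp
  | Seq com com
  | Cond bexp com com
  | While bexp com

record state =
  regs :: "nat \<Rightarrow> nat"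
  arrs :: "nat \<Rightarrow> nat \<Rightarrow> nat"

fun aval :: "aexp \<Rightarrow> state \<Rightarrow> nat" where
  "aval (Lit v) s = v"
| "aval (Reg x) s = regs s x"
| "aval (Elem a e) s = arrs s a (aval e s)"
| "aval (Add e f) s = aval e s + aval f s"
| "aval (Sub e f) s = aval e s - aval f s"
| "aval (Mul e f) s = aval e s * aval f s"
| "aval (Quot e f) s = aval e s div aval f s"
| "aval (Rem e f) s = aval e s mod aval f s"

fun bval :: "bexp \<Rightarrow> state \<Rightarrow> bool" where
  "bval (Less e f) s \<longleftrightarrow> aval e s < aval f s"
| "bval (Equal e f) s \<longleftrightarrow> aval e s = aval f s"
| "bval (Neg b) s \<longleftrightarrow> \<not> bval b s"
| "bval (Conj b b') s \<longleftrightarrow> bval b s \<and> bval b' s"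
| "bval (Disj b b') s \<longleftrightarrow> bval b s \<or> bval b' s"

fun acost :: "aexp \<Rightarrow> nat" where
  "acost (Lit v) = 0"
| "acost (Reg x) = 0"
| "acost (Elem a e) = acost e + 1"
| "acost (Add e f) = acost e + acost f + 1"
| "acost (Sub e f) = acost e + acost f + 1"
| "acost (Mul e f) = acost e + acost f + 1"
| "acost (Quot e f) = acost e + acost f + 1"
| "acost (Rem e f) = acost e + acost f + 1"

fun bcost :: "bexp \<Rightarrow> nat" where
  "bcost (Less e f) = acost e + acost f + 1"
| "bcost (Equal e f) = acost e + acost f + 1"
| "bcost (Neg b) = bcost b + 1"
| "bcost (Conj b b') = bcost b + bcost b' + 1"
| "bcost (Disj b b') = bcost b + bcost b' + 1"

fun subexps :: "aexp \<Rightarrow> aexp set" where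
  "subexps (Lit v) = {Lit v}"
| "subexps (Reg x) = {Reg x}"
| "subexps (Elem a e) = insert (Elem a e) (subexps e)"
| "subexps (Add e f) = insert (Add e f) (subexps e \<union> subexps f)"
| "subexps (Sub e f) = insert (Sub e f) (subexps e \<union> subexps f)"
| "subexps (Mul e f) = insert (Mul e f) (subexps e \<union> subexps f)"
| "subexps (Quot e f) = insert (Quot e f) (subexps e \<union> subexps f)"
| "subexps (Rem e f) = insert (Rem e f) (subexps e \<union> subexps f)"

definition afits :: "nat \<Rightarrow> aexp \<Rightarrow> state \<Rightarrow> bool" where
  "afits w e s \<longleftrightarrow> (\<forall>f\<in>subexps e. aval f s \<le> w)"

fun bfits :: "nat \<Rightarrow> bexp \<Rightarrow> state \<Rightarrow> bool" where
  "bfits w (Less e f) s \<longleftrightarrow> afits w e s \<and> afits w f s"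
| "bfits w (Equal e f) s \<longleftrightarrow> afits w e s \<and> afits w f s"
| "bfits w (Neg b) s \<longleftrightarrow> bfits w b s"
| "bfits w (Conj b b') s \<longleftrightarrow> bfits w b s \<and> bfits w b' s"
| "bfits w (Disj b b') s \<longleftrightarrow> bfits w b s \<and> bfits w b' s"

text \<open>
  \<open>exec w p s T s'\<close>: with word bound \<open>w\<close>, the program \<open>p\<close> started in state \<open>s\<close> halts after exactly
  \<open>T\<close> steps in state \<open>s'\<close>. For given \<open>w\<close>, \<open>p\<close> and \<open>s\<close> there is at most one such pair
  (lemma \<open>exec_deterministic\<close>).
\<close>

inductive exec :: "nat \<Rightarrow> com \<Rightarrow> state \<Rightarrow> nat \<Rightarrow> state \<Rightarrow> bool" for w :: nat where
  Skip: "exec w Skip s 1 s"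
| Assign: "afits w e s \<Longrightarrow>
    exec w (Assign x e) s (acost e + 1) (s\<lparr>regs := (regs s)(x := aval e s)\<rparr>)"
| Store: "afits w i s \<Longrightarrow> afits w e s \<Longrightarrow>
    exec w (Store a i e) s (acost i + acost e + 1)
      (s\<lparr>arrs := (arrs s)(a := (arrs s a)(aval i s := aval e s))\<rparr>)"
| Seq: "exec w p s T s' \<Longrightarrow> exec w q s' T' s'' \<Longrightarrow> exec w (Seq p q) s (T + T') s''"
| Cond_True: "bfits w b s \<Longrightarrow> bval b s \<Longrightarrow> exec w p s T s' \<Longrightarrow>
    exec w (Cond b p q) s (bcost b + 1 + T) s'"
| Cond_False: "bfits w b s \<Longrightarrow> \<not> bval b s \<Longrightarrow> exec w q s T s' \<Longrightarrow>
    exec w (Cond b p q) s (bcost b + 1 + T) s'"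
| While_False: "bfits w b s \<Longrightarrow> \<not> bval b s \<Longrightarrow> exec w (While b p) s (bcost b + 1) s"
| While_True: "bfits w b s \<Longrightarrow> bval b s \<Longrightarrow> exec w p s T s' \<Longrightarrow>
    exec w (While b p) s' T' s'' \<Longrightarrow> exec w (While b p) s (bcost b + 1 + T + T') s''"

inductive_cases exec_SkipE: "exec w Skip s T s'"
inductive_cases exec_AssignE: "exec w (Assign x e) s T s'"
inductive_cases exec_StoreE: "exec w (Store a i e) s T s'"
inductive_cases exec_SeqE: "exec w (Seq p q) s T s'"
inductive_cases exec_CondE: "exec w (Cond b p q) s T s'"
inductive_cases exec_WhileE: "exec w (While b p) s T s'"

lemma exec_deterministic:
  assumes "exec w p s T s'" and "exec w p s U u"
  shows "U = T \<and> u = s'"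
  using assms
proof (induction arbitrary: U u rule: exec.induct)
  case (Skip s)
  then show ?case by (auto elim: exec_SkipE)
next
  case (Assign e s x)
  from Assign.prems show ?case by (auto elim: exec_AssignE)
next
  case (Store i s e a)
  from Store.prems show ?case by (auto elim: exec_StoreE)
next
  case (Seq p s T s' q T' s'')
  from Seq.prems obtain T1 s1 T2 where
    1: "exec w p s T1 s1" "exec w q s1 T2 u" "U = T1 + T2" by (rule exec_SeqE)
  show ?case using Seq.IH(1)[OF 1(1)] Seq.IH(2)[of T2 u] 1 by simp
next
  case (Cond_True b s p T s' q)
  from Cond_True.prems obtain T1 where "U = bcost b + 1 + T1" "exec w p s T1 u"
    by (rule exec_CondE) (use Cond_True.hyps in simp_all)
  then show ?case using Cond_True.IH[of T1 u] by simp
next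
  case (Cond_False b s q T s' p)
  from Cond_False.prems obtain T1 where "U = bcost b + 1 + T1" "exec w q s T1 u"
    by (rule exec_CondE) (use Cond_False.hyps in simp_all)
  then show ?case using Cond_False.IH[of T1 u] by simp
next
  case (While_False b s p)
  from While_False.prems show ?case
    by (rule exec_WhileE) (use While_False.hyps in simp_all)
next
  case (While_True b s p T s' T' s'')
  from While_True.prems obtain T1 s1 T2 where
    1: "U = bcost b + 1 + T1 + T2" "exec w p s T1 s1" "exec w (While b p) s1 T2 u"
    by (rule exec_WhileE) (use While_True.hyps in simp_all)
  show ?case using While_True.IH(1)[OF 1(2)] While_True.IH(2)[of T2 u] 1 by simp
qed

text \<open>
  The decoder receives \<open>k\<close> and \<open>d\<close> in registers 0 and 1 and the vector \<open>\<tau>\<close> at the indices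
  \<open>1, \<dots>, kd\<close> of array 0, everything else being 0. It leaves its result at the same indices of
  array 1. It is not given \<open>t\<close>.
\<close>

definition decoder_input :: "nat \<Rightarrow> nat \<Rightarrow> (nat \<Rightarrow> nat) \<Rightarrow> state" where
  "decoder_input k d \<tau> =
     \<lparr>regs = (\<lambda>_. 0)(0 := k, 1 := d),
      arrs = (\<lambda>_ _. 0)(0 := (\<lambda>j. if j \<in> {1..k*d} then \<tau> j else 0))\<rparr>"

definition decoder_output :: "nat \<Rightarrow> state \<Rightarrow> nat \<Rightarrow> nat" where
  "decoder_output n s = (\<lambda>j. if j \<in> {1..n} then arrs s 1 j else j)"

end

theory Submission
  imports Defs
begin

text \<open>
  Every codeword has the form \<open>\<sigma>\<^sub>0 \<circ> e\<^sub>d(a\<^sub>d) \<circ> \<dots> \<circ> e\<^sub>1(a\<^sub>1)\<close>, where \<open>e\<^sub>m\<close> moves a permutation to the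
  positions from \<open>k(m-1) + 1\<close> on, \<open>a\<^sub>m\<close> lies in the auxiliary code for \<open>m < d\<close>, and \<open>a\<^sub>d \<in> S\<^sub>k\<close>.
  The factors are recovered in the order \<open>m = 1, \<dots>, d\<close>. When block \<open>m\<close> is reached, its \<open>k + 1\<close>
  positions hold the \<open>k\<close> values congruent to \<open>m\<close> modulo \<open>d\<close> and one value of a later block, which
  is carried over. Rounding each entry to the nearest value of class \<open>m\<close> determines \<open>a\<^sub>m\<close> up to
  one ambiguity: two positions may be rounded to the same value \<open>v\<close>, leaving the candidates \<open>a\<close>
  and \<open>(v, k+1) \<circ> a\<close>. By the defining property of auxiliary codes only one of them is a codeword,
  and it can be found in \<open>O(k)\<close> steps. For \<open>k = 3\<close> one checks whether \<open>1\<close> follows \<open>4\<close>. Otherwise exactly one candidate is odd, and an odd codeword occurs only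
  among the translates of the \<open>\<beta>\<^sub>r\<close>, which two entries distinguish from the odd neighbours of
  even codewords.
\<close>

section \<open>Which transposes of auxiliary codewords can be confused\<close>

definition push_perm :: "nat \<Rightarrow> nat \<Rightarrow> nat" where
  "push_perm j = push_up 1 j id"

lemma push_perm_apply: "push_perm j p = (if p = 1 then j else if 1 < p \<and> p \<le> j then p - 1 else p)"
  by (simp add: push_perm_def push_up_def)

lemma push_up_eq_comp: "push_up 1 j a = a \<circ> push_perm j"
  by (auto simp: push_up_def push_perm_apply fun_eq_iff)

lemma push_perm_1: "push_perm 1 = id"
  by (auto simp: push_perm_apply fun_eq_iff)

text \<open>Splitting off one adjacent transposition allows induction on \<open>j\<close>, for the
  support of the cycle as well as for its parity.\<close>

lemma push_perm_Suc:
  assumes "j \<ge> 1"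
  shows "push_perm (Suc j) = transpose j (Suc j) \<circ> push_perm j"
  using assms by (auto simp: push_perm_apply fun_eq_iff transpose_def)

lemma push_perm_permutes:
  assumes "j \<ge> 1"
  shows "push_perm j permutes {1..j}"
  using assms
proof (induction j rule: dec_induct)
  case base
  show ?case by (simp only: push_perm_1 permutes_id)
next
  case (step j)
  have "transpose j (Suc j) permutes {1..Suc j}"
    using step.hyps by (intro permutes_swap_id) auto
  moreover have "push_perm j permutes {1..Suc j}"
    using step.IH by (rule permutes_subset) auto
  ultimately show ?case
    using push_perm_Suc step.hyps by (metis permutes_compose)
qed

lemma permutation_push_perm:
  assumes "j \<ge> 1"
  shows "permutation (push_perm j)"
  using push_perm_permutes[OF assms] permutation_permutes finite_atLeastAtMost by blast

lemma evenperm_push_perm: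
  assumes "j \<ge> 1"
  shows "evenperm (push_perm j) \<longleftrightarrow> odd j"
  using assms
proof (induction j rule: dec_induct)
  case base
  show ?case unfolding push_perm_1 by simp
next
  case (step i)
  have "evenperm (push_perm (Suc i)) \<longleftrightarrow> evenperm (transpose i (Suc i)) = evenperm (push_perm i)"
    unfolding push_perm_Suc[OF step.hyps(1)]
    by (intro evenperm_comp permutation_swap_id permutation_push_perm step.hyps)
  then show ?case
    unfolding step.IH evenperm_swap by simp
qed

lemma push_up_permutes:
  assumes "a permutes {1..l}" "1 < j" "j \<le> l"
  shows "push_up 1 j a permutes {1..l}"
proof -
  have "push_perm j permutes {1..l}"
    using push_perm_permutes[of j] assms(2,3) by (auto intro: permutes_subset)
  then show ?thesis
    using assms(1) push_up_eq_comp by (metis permutes_compose)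
qed

text \<open>Here \<open>inv\<close> inverts an operator on functions. As \<open>push_up 1 j\<close>
  multiplies by \<open>push_perm j\<close> on the right, its inverse multiplies by the inverse
  cycle.\<close>

lemma inv_push_up:
  assumes "j \<ge> 1"
  shows "inv (push_up 1 j) a = a \<circ> inv (push_perm j)"
proof (rule inv_f_eq)
  have bij: "bij (push_perm j)"
    using push_perm_permutes[OF assms] by (rule permutes_bij)
  show "inj (push_up 1 j)"
  proof (rule injI)
    fix a b
    assume "push_up 1 j a = push_up 1 j b"
    then have "a (push_perm j x) = b (push_perm j x)" for x
      by (metis push_up_eq_comp comp_apply)
    then show "a = b"
      using bij by (metis bij_pointE ext)
  qed
  show "push_up 1 j (a \<circ> inv (push_perm j)) = a"
    by (subst push_up_eq_comp) (metis bij bij_is_inj comp_assoc comp_id inv_o_cancel)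
qed

lemma funpow_push_up: "(push_up 1 j ^^ q) id = push_perm j ^^ q"
proof (induction q)
  case (Suc q)
  have "(push_up 1 j ^^ Suc q) id = push_up 1 j (push_perm j ^^ q)"
    unfolding funpow.simps comp_apply Suc.IH ..
  also have "\<dots> = push_perm j ^^ Suc q"
    unfolding push_up_eq_comp[of j] funpow_Suc_right ..
  finally show ?case .
qed simp

lemma evenperm_funpow:
  assumes "permutation p"
  shows "evenperm (p ^^ n) \<longleftrightarrow> evenperm p \<or> even n"
proof (induction n)
  case (Suc n)
  have "evenperm (p ^^ Suc n) \<longleftrightarrow> evenperm p = evenperm (p ^^ n)"
    unfolding funpow.simps
    by (rule evenperm_comp[OF assms permutation_funpow[OF assms]])
  with Suc show ?case
    unfolding even_Suc by metis
qed simp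

lemma evenperm_cycle_of_list:
  assumes "distinct cs" "cs \<noteq> []"
  shows "evenperm (cycle_of_list cs) \<longleftrightarrow> odd (length cs)"
  using assms
proof (induction cs rule: cycle_of_list.induct)
  case (1 i j cs)
  then show ?case
    unfolding cycle_of_list.simps evenperm_comp[OF permutation_swap_id permutation_of_cycle]
      evenperm_swap by simp
qed auto

lemma pi_tilde_inv:
  assumes "m \<ge> 1"
  shows "inv (pi_tilde m) = push_perm (2*m - 1)"
proof -
  have "bij (push_perm (2*m - 1))"
    using push_perm_permutes[of "2*m-1"] assms permutes_bij by fastforce
  moreover have "pi_tilde m = inv (push_perm (2*m - 1))"
    using inv_push_up[of "2*m - 1" id] assms by (simp add: pi_tilde_def)
  ultimately show ?thesis by (simp add: inv_inv_eq)
qed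

section \<open>Parity and extreme values of \<open>pi_hat\<close> and \<open>beta\<close>\<close>

context
  fixes m :: nat
  assumes m: "m \<ge> 2"
begin

definition cycle_list :: "nat list" where
  "cycle_list = (2*m + 2) # rev [2..<2*m + 1]"

lemma cycle_list: "distinct cycle_list" "length cycle_list = 2 * m"
  "set cycle_list = {2..2*m} \<union> {2*m+2}" "cycle_list \<noteq> []"
  using m by (auto simp: cycle_list_def)

lemma pi_hat_eq: "pi_hat m r = (transpose 1 (2*m + 1) ^^ r) \<circ> (cycle_of_list cycle_list ^^ r)"
  by (simp add: pi_hat_def cycle_list_def)

lemma permutation_pi_hat: "permutation (pi_hat m r)"
  unfolding pi_hat_eq
  by (intro permutation_compose permutation_funpow permutation_swap_id permutation_of_cycle)

text \<open>A transposition and a cycle of even length \<open>2 * m\<close> are both odd, so the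
  parities of their \<open>r\<close>-th powers cancel.\<close>

lemma evenperm_pi_hat: "evenperm (pi_hat m r)"
proof -
  have "evenperm (transpose 1 (2*m + 1) ^^ r) \<longleftrightarrow> even r"
    using m by (simp add: evenperm_funpow[OF permutation_swap_id] evenperm_swap)
  moreover have "evenperm (cycle_of_list cycle_list ^^ r) \<longleftrightarrow> even r"
    using cycle_list
    by (simp add: evenperm_funpow[OF permutation_of_cycle] evenperm_cycle_of_list)
  ultimately show ?thesis
    unfolding pi_hat_eq
    by (subst evenperm_comp)
      (simp_all add: permutation_funpow permutation_swap_id permutation_of_cycle)
qed

lemma funpow_fixed: "f x = x \<Longrightarrow> (f ^^ n) x = x"
  by (induction n) auto

text \<open>The cycle avoids \<open>1\<close> and \<open>2*m + 1\<close>, and the transposition only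
  exchanges them.\<close>

lemma pi_hat_ends:
  assumes "x \<in> {1, 2*m + 1}"
  shows "pi_hat m r x \<in> {1, 2*m + 1}"
proof -
  have "cycle_of_list cycle_list x = x"
    using assms cycle_list m by (intro id_outside_supp) auto
  then have *: "(cycle_of_list cycle_list ^^ r) x = x" by (rule funpow_fixed)
  have "(transpose 1 (2*m + 1) ^^ r) x \<in> {1, 2*m + 1}"
    using assms by (induction r) auto
  with * show ?thesis by (simp add: pi_hat_eq)
qed

text \<open>Cycling \<open>r\<close> times carries the head \<open>2*m + 2\<close> of
  \<open>cycle_list\<close> to its entry at index \<open>r\<close>. For these \<open>r\<close> that
  entry lies past the head, and the transposition fixes it.\<close>

lemma pi_hat_last:
  assumes "r \<in> {1..2*m - 1}"
  shows "pi_hat m r (2*m + 2) \<in> {2..2*m}"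
proof -
  let ?c = "cycle_of_list cycle_list"
  have r: "r < length cycle_list" using assms m cycle_list by auto
  have "map (?c ^^ r) cycle_list = rotate r cycle_list"
    using cyclic_rotation cycle_list(1) by blast
  then have "(?c ^^ r) (hd cycle_list) = hd (rotate r cycle_list)"
    using cycle_list(4) by (metis list.map_sel(1))
  also have "\<dots> = cycle_list ! r"
    using r cycle_list(4) by (simp add: hd_rotate_conv_nth)
  finally have c: "(?c ^^ r) (2*m + 2) = cycle_list ! r"
    by (simp add: cycle_list_def)
  have "cycle_list ! r = rev [2..<2*m + 1] ! (r - 1)"
    using assms by (cases r) (auto simp: cycle_list_def)
  also have "\<dots> \<in> set (rev [2..<2*m + 1])"
    using assms m by (intro nth_mem) auto
  finally have v: "cycle_list ! r \<in> {2..2*m}" by auto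
  then have "transpose 1 (2*m + 1) (cycle_list ! r) = cycle_list ! r"
    by (auto simp: transpose_def)
  then have "(transpose 1 (2*m + 1) ^^ r) (cycle_list ! r) = cycle_list ! r"
    by (rule funpow_fixed)
  with v c show ?thesis by (simp add: pi_hat_eq)
qed

text \<open>Undoing the push moves the entries of \<open>pi_hat\<close> at \<open>1\<close> and
  \<open>2*m + 1\<close> to the positions \<open>2*m + 2\<close> and \<open>2*m\<close>. A cycle of
  even length is odd, so the parity is reversed.\<close>

lemma beta_properties:
  shows "\<not> evenperm (beta m r)" "permutation (beta m r)"
    "beta m r (2*m + 2) \<in> {1, 2*m + 1}" "beta m r (2*m) \<in> {1, 2*m + 1}"
proof -
  let ?p = "push_perm (2*m + 2)"
  have eq: "beta m r = pi_hat m r \<circ> inv ?p"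
    unfolding beta_def by (rule inv_push_up) simp
  have p: "permutation ?p" "bij ?p"
    using permutation_push_perm[of "2*m+2"] push_perm_permutes[of "2*m+2"] permutes_bij by auto
  show "\<not> evenperm (beta m r)"
    unfolding eq evenperm_comp[OF permutation_pi_hat permutation_inverse[OF p(1)]]
    using p evenperm_pi_hat by (simp add: evenperm_inv evenperm_push_perm)
  show "permutation (beta m r)"
    using p permutation_pi_hat by (simp add: eq permutation_compose permutation_inverse)
  have "inv ?p (2*m + 2) = 1" "inv ?p (2*m) = 2*m + 1"
    using p(2) m by (auto intro!: inv_f_eq bij_is_inj simp: push_perm_apply)
  then show "beta m r (2*m + 2) \<in> {1, 2*m + 1}" "beta m r (2*m) \<in> {1, 2*m + 1}"
    unfolding eq using pi_hat_ends by auto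
qed

end

text \<open>
  For \<open>l = 2m + 2 \<ge> 6\<close>, the two conditions say that \<open>pi_tilde m \<circ> a\<close> takes values in \<open>{1, 2m+1}\<close>
  at \<open>l\<close> and \<open>l - 2\<close>, as every \<open>\<beta>\<^sub>r\<close> does. The odd permutations of the auxiliary code are exactly
  those for which \<open>pi_tilde m \<circ> a\<close> is some \<open>\<beta>\<^sub>r\<close>.
\<close>

definition beta_like :: "nat \<Rightarrow> (nat \<Rightarrow> nat) \<Rightarrow> bool" where
  "beta_like l a \<longleftrightarrow> even l \<and> a l \<in> {l - 3, l - 1} \<and> a (l - 2) \<in> {l - 3, l - 1}"

definition four_then_one :: "(nat \<Rightarrow> nat) \<Rightarrow> bool" where
  "four_then_one a \<longleftrightarrow> (\<exists>i\<in>{1..4}. a i = 4 \<and> a (i mod 4 + 1) = 1)"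

text \<open>
  If \<open>a\<close> is resolvable, then for each \<open>v < l\<close> the pair \<open>{a, transpose v l \<circ> a}\<close> determines \<open>a\<close>:
  for \<open>l \<noteq> 4\<close> it is the odd member of the pair if that is \<open>beta_like\<close>, and the even one otherwise.
\<close>

definition resolvable :: "nat \<Rightarrow> (nat \<Rightarrow> nat) \<Rightarrow> bool" where
  "resolvable l a \<longleftrightarrow>
     (if l = 4 then four_then_one a \<and> (\<forall>v\<in>{1..3}. \<not> four_then_one (transpose v 4 \<circ> a))
      else (evenperm a \<or> beta_like l a) \<and>
        (evenperm a \<longrightarrow> (\<forall>v\<in>{1..l - 1}. \<not> beta_like l (transpose v l \<circ> a))))"

text \<open>\<open>P0'\<close> and the sets \<open>P r\<close> consist of even permutations; only
  the \<open>beta m r\<close> are odd. Left multiplication by the even cycle \<open>?c\<close> keeps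
  the parity.\<close>

lemma aux_set_even_resolvable:
  assumes m: "m \<ge> 2" and "aux_set_even m A" and a: "a \<in> A"
  shows "resolvable (2*m + 2) a"
proof -
  let ?c = "push_perm (2*m - 1)"
  obtain P where P: "\<And>r. r \<in> {1..2*m - 1} \<Longrightarrow> P r \<subseteq> even_perms_ending m r"
    and A: "A = (\<lambda>\<pi>. ?c \<circ> \<pi>) ` (P0' m \<union> (\<Union>r\<in>{1..2*m - 1}. P r) \<union> beta m ` {1..2*m})"
  proof -
    have inv: "inv (pi_tilde m) = ?c" using m by (intro pi_tilde_inv) auto
    obtain P where P: "\<forall>r\<in>{1..2*m - 1}.
             if m = 2 then P r \<subseteq> even_perms_ending m r \<and> card (P r) = 57
             else P r = even_perms_ending m r"
        "A = (\<lambda>\<pi>. inv (pi_tilde m) \<circ> \<pi>) `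
                (P0' m \<union> (\<Union>r\<in>{1..2*m - 1}. P r) \<union> beta m ` {1..2*m})"
      using assms(2) unfolding aux_set_even_def by blast
    show thesis
    proof (rule that)
      show "P r \<subseteq> even_perms_ending m r" if "r \<in> {1..2*m - 1}" for r
        using bspec[OF P(1) that] by (auto split: if_splits)
    qed (use P(2) inv in simp)
  qed
  from a obtain b where ab: "a = ?c \<circ> b"
    and b: "b \<in> P0' m \<union> (\<Union>r\<in>{1..2*m - 1}. P r) \<union> beta m ` {1..2*m}"
    unfolding A by auto
  have c: "permutation ?c" "evenperm ?c"
    using m by (auto simp: permutation_push_perm evenperm_push_perm)
  have c_fix: "?c x = x" if "x > 2*m - 1" for x
    using that m by (auto simp: push_perm_apply)
  have par: "evenperm a = evenperm b" if "permutation b"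
    unfolding ab evenperm_comp[OF c(1) that] using c(2) by simp
  consider (0) "b \<in> P0' m" | (ending) r where "r \<in> {1..2*m - 1}" "b \<in> even_perms_ending m r"
    | (beta) r where "b = beta m r"
    using b P by blast
  then show ?thesis
  proof cases
    case 0
    then obtain q where q: "b = ?c ^^ q"
      unfolding P0'_def funpow_push_up by blast
    have "evenperm a"
      using c by (subst par) (auto simp: q permutation_funpow evenperm_funpow)
    \<comment> \<open>The value \<open>2*m\<close> at position \<open>l - 2\<close> rules out
      \<open>beta_like\<close> for every transpose: an exchange with \<open>l\<close> can only turn
      it into \<open>2*m + 2\<close>.\<close>
    moreover have "a (2*m) = 2*m"
      using c_fix m funpow_fixed[of m ?c "2*m" q] by (simp add: ab q)
    ultimately show ?thesis
      using m by (auto simp: resolvable_def beta_like_def transpose_def)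
  next
    case ending
    have eb: "evenperm b" "permutation b" "b (2*m + 2) \<in> {2..2*m}"
      using ending pi_hat_last[OF m, of r] permutation_permutes[of b]
      by (auto simp: even_perms_ending_def even_perms_def sym_grp_def)
    \<comment> \<open>Besides the two values tested by \<open>beta_like\<close>, the value
      \<open>l = 2*m + 2\<close> is excluded too, since a transposition could turn it into a tested
      one.\<close>
    have "?c x \<notin> {2*m - 1, 2*m + 1, 2*m + 2}" if "x \<in> {2..2*m}" for x
      using that m by (auto simp: push_perm_apply split: if_splits)
    then have "a (2*m + 2) \<notin> {2*m - 1, 2*m + 1, 2*m + 2}"
      using eb(3) by (simp only: ab comp_apply) blast
    then have "a (2*m + 2) \<noteq> 2*m - 1" "a (2*m + 2) \<noteq> 2*m + 1" "a (2*m + 2) \<noteq> 2*m + 2"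
      by auto
    then show ?thesis
      using par eb m by (auto simp: resolvable_def beta_like_def transpose_def)
  next
    case beta
    have "\<not> evenperm a"
      using beta_properties[OF m] par beta by simp
    moreover have "?c x \<in> {2*m - 1, 2*m + 1}" if "x \<in> {1, 2*m + 1}" for x
      using that m unfolding push_perm_apply by (cases "x = 1") auto
    then have "a (2*m + 2) \<in> {2*m - 1, 2*m + 1}" "a (2*m) \<in> {2*m - 1, 2*m + 1}"
      unfolding ab comp_apply beta using beta_properties[OF m] by blast+
    ultimately show ?thesis
      using m by (auto simp: resolvable_def beta_like_def)
  qed
qed

lemma transpose_comp_sym_grp:
  assumes "a \<in> sym_grp l" "v \<in> {1..l}"
  shows "transpose v l \<circ> a \<in> sym_grp l"
  using assms permutes_compose[of a "{1..l}" "transpose v l"] permutes_swap_id[of v "{1..l}" l]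
  by (auto simp: sym_grp_def)

text \<open>For odd \<open>l\<close> all codewords are even and \<open>beta_like\<close> fails by
  its parity condition. For \<open>l = 4\<close> the defining property of \<open>G_aux\<close> is
  used: a transpose having \<open>1\<close> after \<open>4\<close> would itself be a
  codeword.\<close>

lemma auxiliary_code_resolvable:
  assumes "auxiliary_code l c js" "l \<ge> 3" "a \<in> set c"
  shows "resolvable l a"
proof -
  have aux: "aux_set l (set c)"
    and swap: "\<And>q. q \<in> {1..l - 1} \<Longrightarrow> transpose q l \<circ> a \<notin> set c"
    and sym: "a \<in> sym_grp l"
    using assms(1,3) by (auto simp: auxiliary_code_def G_aux_def G_up_def)
  consider (odd) "odd l" | (4) "l = 4" | (even) m where "m \<ge> 2" "l = 2*m + 2"
  proof (cases "odd l \<or> l = 4")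
    case False
    then obtain m where "l = 2 * m" by blast
    with False assms(2) show ?thesis
      by (intro that(3)[of "m - 1"]) auto
  qed (use that in blast)
  then show ?thesis
  proof cases
    case odd
    then have "evenperm a"
      using aux assms(3) by (auto simp: aux_set_def even_perms_def split: if_splits)
    with odd show ?thesis by (auto simp: resolvable_def beta_like_def)
  next
    case 4
    then have set: "set c = {\<pi> \<in> sym_grp 4. four_then_one \<pi>}"
      using aux by (simp add: aux_set_def four_then_one_def)
    have "\<not> four_then_one (transpose v 4 \<circ> a)" if "v \<in> {1..3}" for v
      using swap[of v] transpose_comp_sym_grp[OF sym, of v] that 4 set by auto
    with set assms(3) 4 show ?thesis by (simp add: resolvable_def)
  next
    case even
    then have "aux_set_even m (set c)"
      using aux by (auto simp: aux_set_def)
    with even assms(3) show ?thesis using aux_set_even_resolvable by blast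
  qed
qed

section \<open>Codewords as products of block permutations\<close>

definition embed :: "nat \<Rightarrow> nat \<Rightarrow> (nat \<Rightarrow> nat) \<Rightarrow> nat \<Rightarrow> nat" where
  "embed P l a p = (if p \<in> {P + 1..P + l} then P + a (p - P) else p)"

lemma embed_id: "embed P l id = id"
  by (auto simp: embed_def fun_eq_iff)

lemma mem_embed_id:
  assumes "\<rho> \<in> F" "id \<in> S"
  shows "\<rho> \<in> {\<rho> \<circ> embed P l a | \<rho> a. \<rho> \<in> F \<and> a \<in> S}"
proof -
  have "\<rho> = \<rho> \<circ> embed P l id" by (simp only: embed_id comp_id)
  then have "\<rho> = \<rho> \<circ> embed P l id \<and> \<rho> \<in> F \<and> id \<in> S" using assms by (rule conjI[OF _ conjI])
  then show ?thesis by (intro CollectI exI)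
qed

lemma push_up_comp_embed:
  assumes "a permutes {1..l}" "1 < i" "i \<le> l"
  shows "push_up (P + 1) (P + i) (\<rho> \<circ> embed P l a) = \<rho> \<circ> embed P l (push_up 1 i a)"
proof
  fix p
  show "push_up (P + 1) (P + i) (\<rho> \<circ> embed P l a) p = (\<rho> \<circ> embed P l (push_up 1 i a)) p"
    using assms(2,3) by (auto simp: push_up_def embed_def Suc_diff_le)
qed

text \<open>The heart of the construction: for \<open>l = k + 1\<close>, a push from the first
  position of a block is the push from the first position of the next block, followed by the first
  auxiliary transition inside the block.\<close>

lemma push_up_split:
  assumes "P + l < j" "l \<ge> 1"
  shows "push_up (P + 1) j \<rho> = push_up (P + l) j \<rho> \<circ> embed P l (push_up 1 l id)"
proof
  fix p
  show "push_up (P + 1) j \<rho> p = (push_up (P + l) j \<rho> \<circ> embed P l (push_up 1 l id)) p"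
    using assms by (auto simp: push_up_def embed_def)
qed

text \<open>Unlike \<open>codewords\<close>, the list includes the state after the last transition,
  so that sequences can be concatenated.\<close>

fun states :: "(nat \<Rightarrow> nat) \<Rightarrow> (nat \<times> nat) list \<Rightarrow> (nat \<Rightarrow> nat) list" where
  "states \<sigma> [] = [\<sigma>]"
| "states \<sigma> ((i, j) # ts) = \<sigma> # states (push_up i j \<sigma>) ts"

lemma set_codewords_subset_states: "set (codewords \<sigma> ts) \<subseteq> set (states \<sigma> ts)"
  by (induction \<sigma> ts rule: states.induct) auto

lemma hd_states: "hd (states \<sigma> ts) = \<sigma>"
  by (cases "(\<sigma>, ts)" rule: states.cases) auto

lemma states_ne [simp]: "states \<sigma> ts \<noteq> []"
  by (cases "(\<sigma>, ts)" rule: states.cases) auto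

lemma states_append: "set (states \<sigma> (ts @ us)) = set (states \<sigma> ts) \<union> set (states (last (states \<sigma> ts)) us)"
proof (induction \<sigma> ts rule: states.induct)
  case (1 \<sigma>)
  then show ?case using hd_states[of \<sigma> us] hd_in_set[of "states \<sigma> us"] by auto
qed auto

text \<open>No later block exists to supply a value to block \<open>d\<close>, so its factor lies in
  \<open>sym_grp k\<close>; embedded with length \<open>k + 1\<close>, it fixes the extra
  slot.\<close>

definition block_perms :: "nat \<Rightarrow> nat \<Rightarrow> (nat \<Rightarrow> nat) set \<Rightarrow> nat \<Rightarrow> (nat \<Rightarrow> nat) set" where
  "block_perms k d A m = (if m = d then sym_grp k else A)"

text \<open>\<open>products k d A r\<close> contains \<open>C\<^sub>m\<close> for \<open>m = d + 1 - r\<close>.\<close>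

fun products :: "nat \<Rightarrow> nat \<Rightarrow> (nat \<Rightarrow> nat) set \<Rightarrow> nat \<Rightarrow> (nat \<Rightarrow> nat) set" where
  "products k d A 0 = {sigma0 k d}"
| "products k d A (Suc r) =
     {\<rho> \<circ> embed (k * (d - r - 1)) (k + 1) a | \<rho> a.
        \<rho> \<in> products k d A r \<and> a \<in> block_perms k d A (d - r)}"

lemma last_block_states:
  assumes "a \<in> sym_grp k" "\<forall>r\<in>set rs. 1 < r \<and> r \<le> k"
  shows "set (states (\<rho> \<circ> embed P (k + 1) a) (map (\<lambda>r. (P + 1, P + r)) rs))
           \<subseteq> {\<rho> \<circ> embed P (k + 1) b | b. b \<in> sym_grp k}"
  using assms
proof (induction rs arbitrary: a)
  case (Cons r rs)
  have a': "push_up 1 r a \<in> sym_grp k"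
    using Cons.prems push_up_permutes[of a k r] by (auto simp: sym_grp_def)
  have "a permutes {1..k + 1}"
    using Cons.prems by (auto simp: sym_grp_def intro: permutes_subset)
  then have eq: "push_up (P + 1) (P + r) (\<rho> \<circ> embed P (k + 1) a)
      = \<rho> \<circ> embed P (k + 1) (push_up 1 r a)"
    using Cons.prems by (intro push_up_comp_embed) auto
  have IH: "set (states (\<rho> \<circ> embed P (k + 1) (push_up 1 r a))
      (map (\<lambda>r. (P + 1, P + r)) rs)) \<subseteq> {\<rho> \<circ> embed P (k + 1) b | b. b \<in> sym_grp k}"
    using Cons.IH[OF a'] Cons.prems unfolding list.set by blast
  show ?case
    unfolding list.map states.simps list.set insert_subset eq using IH Cons.prems(1) by blast
qed auto

text \<open>After transition \<open>t\<close>, the remaining auxiliary transitions run around the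
  cyclic code back to \<open>c ! 0 = id\<close>, so the block factor has vanished at the
  end.\<close>

lemma aux_cycle_states:
  assumes aux: "auxiliary_code l c js" and "t < length c"
  shows "set (states (\<rho> \<circ> embed P l (c ! ((t + 1) mod length c)))
             (map (\<lambda>i. (P + 1, P + i)) (drop (t + 1) js)))
           \<subseteq> {\<rho> \<circ> embed P l a | a. a \<in> set c} \<and>
         last (states (\<rho> \<circ> embed P l (c ! ((t + 1) mod length c)))
             (map (\<lambda>i. (P + 1, P + i)) (drop (t + 1) js))) = \<rho>"
  using assms(2)
proof (induction "length c - t" arbitrary: t)
  case (Suc x)
  have js: "length js = length c"
    and step: "\<And>r. r < length c \<Longrightarrow> 1 < js ! r \<and> js ! r \<le> l \<and>
        c ! ((r + 1) mod length c) = push_up 1 (js ! r) (c ! r)"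
    and sub: "set c \<subseteq> sym_grp l" and ne: "c \<noteq> []" and hd: "c ! 0 = id"
    using aux by (auto simp: auxiliary_code_def transition_seq_def G_aux_def G_up_def hd_conv_nth)
  show ?case
  proof (cases "t + 1 = length c")
    case True
    then have "id \<in> set c" using hd ne by (metis nth_mem length_greater_0_conv)
    with True js hd show ?thesis by (auto simp: embed_id intro!: exI[of _ id])
  next
    case False
    then have t: "t + 1 < length c" using Suc.prems by simp
    have mem: "c ! (t + 1) \<in> set c" using t by simp
    then have "c ! (t + 1) permutes {1..l}"
      using sub by (auto simp: sym_grp_def)
    then have eq: "push_up (P + 1) (P + js ! (t + 1)) (\<rho> \<circ> embed P l (c ! (t + 1)))
        = \<rho> \<circ> embed P l (c ! ((t + 1 + 1) mod length c))"
      using step[OF t] push_up_comp_embed by metis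
    have drop: "drop (t + 1) js = js ! (t + 1) # drop (t + 1 + 1) js"
      using t js by (metis Cons_nth_drop_Suc Suc_eq_plus1)
    have IH: "set (states (\<rho> \<circ> embed P l (c ! ((t + 1 + 1) mod length c)))
             (map (\<lambda>i. (P + 1, P + i)) (drop (t + 1 + 1) js)))
           \<subseteq> {\<rho> \<circ> embed P l a | a. a \<in> set c} \<and>
         last (states (\<rho> \<circ> embed P l (c ! ((t + 1 + 1) mod length c)))
             (map (\<lambda>i. (P + 1, P + i)) (drop (t + 1 + 1) js))) = \<rho>"
      using Suc.hyps t by (intro Suc.hyps(1)) auto
    show ?thesis
      unfolding drop using IH t mem eq by auto
  qed
qed simp

text \<open>The net effect of an expanded transition is the transition it replaces; in between, only
  a block factor is attached to \<open>\<rho>\<close> or to its successor.\<close>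

lemma aux_block_states:
  assumes aux: "auxiliary_code l c js" and l: "l \<ge> 1" and j: "P + l < j"
    and \<rho>: "\<rho> \<in> F" "push_up (P + l) j \<rho> \<in> F"
  defines "ts \<equiv> (P + 1, j) # map (\<lambda>i. (P + 1, P + i)) (tl js)"
  shows "set (states \<rho> ts) \<subseteq> {\<rho> \<circ> embed P l a | \<rho> a. \<rho> \<in> F \<and> a \<in> set c}"
    and "last (states \<rho> ts) = push_up (P + l) j \<rho>"
proof -
  have ne: "c \<noteq> []" and id: "c ! 0 = id" and js: "js \<noteq> []" "js ! 0 = l"
    and step: "c ! ((0 + 1) mod length c) = push_up 1 (js ! 0) (c ! 0)"
    using aux by (cases js; auto simp: auxiliary_code_def transition_seq_def hd_conv_nth)+
  let ?\<rho> = "push_up (P + l) j \<rho>"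
  have eq: "push_up (P + 1) j \<rho> = ?\<rho> \<circ> embed P l (c ! ((0 + 1) mod length c))"
    unfolding step js id by (rule push_up_split[OF j l])
  have *: "set (states (push_up (P + 1) j \<rho>) (map (\<lambda>i. (P + 1, P + i)) (tl js)))
           \<subseteq> {?\<rho> \<circ> embed P l a | a. a \<in> set c}"
    "last (states (push_up (P + 1) j \<rho>) (map (\<lambda>i. (P + 1, P + i)) (tl js))) = ?\<rho>"
    using aux_cycle_states[OF aux, of 0 ?\<rho> P] ne unfolding eq by (simp_all add: drop_Suc)
  have "id \<in> set c" using ne id by (metis nth_mem length_greater_0_conv)
  then have mem: "\<rho> \<in> {\<rho> \<circ> embed P l a | \<rho> a. \<rho> \<in> F \<and> a \<in> set c}"
    using \<rho>(1) by (intro mem_embed_id)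
  have "{?\<rho> \<circ> embed P l a | a. a \<in> set c} \<subseteq> {\<rho> \<circ> embed P l a | \<rho> a. \<rho> \<in> F \<and> a \<in> set c}"
    using \<rho>(2) by blast
  with *(1) have "set (states (push_up (P + 1) j \<rho>) (map (\<lambda>i. (P + 1, P + i)) (tl js)))
      \<subseteq> {\<rho> \<circ> embed P l a | \<rho> a. \<rho> \<in> F \<and> a \<in> set c}"
    by (rule order_trans)
  with mem show "set (states \<rho> ts) \<subseteq> {\<rho> \<circ> embed P l a | \<rho> a. \<rho> \<in> F \<and> a \<in> set c}"
    unfolding ts_def states.simps list.set insert_subset by (rule conjI)
  show "last (states \<rho> ts) = ?\<rho>"
    unfolding ts_def using *(2) by simp
qed

lemma expanded_states:
  assumes aux: "auxiliary_code l c js" and l: "l \<ge> 1"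
    and ts: "\<forall>(i, j)\<in>set ts. i = P + l \<and> P + l < j"
    and F: "set (states \<rho> ts) \<subseteq> F"
  shows "set (states \<rho> (concat (map (\<lambda>(_, j). (P + 1, j) # map (\<lambda>i. (P + 1, P + i)) (tl js)) ts)))
           \<subseteq> {\<rho> \<circ> embed P l a | \<rho> a. \<rho> \<in> F \<and> a \<in> set c}"
  using ts F
proof (induction ts arbitrary: \<rho>)
  case Nil
  have "id \<in> set c" using aux hd_in_set[of c] by (auto simp: auxiliary_code_def)
  moreover have "\<rho> \<in> F" using Nil by simp
  ultimately have "\<rho> \<in> {\<rho> \<circ> embed P l a | \<rho> a. \<rho> \<in> F \<and> a \<in> set c}"
    by (intro mem_embed_id)
  then show ?case
    unfolding list.map concat.simps states.simps list.set insert_subset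
    by (intro conjI empty_subsetI)
next
  case (Cons t ts)
  obtain j where t: "t = (P + l, j)" "P + l < j"
    using Cons.prems(1) by (cases t) auto
  have F: "\<rho> \<in> F" "set (states (push_up (P + l) j \<rho>) ts) \<subseteq> F"
    using Cons.prems(2) unfolding t(1) by simp_all
  then have "push_up (P + l) j \<rho> \<in> F"
    using hd_states hd_in_set[OF states_ne] by (metis subsetD)
  note block = aux_block_states[OF aux l t(2) F(1) this]
  have IH: "set (states (push_up (P + l) j \<rho>)
       (concat (map (\<lambda>(_, j). (P + 1, j) # map (\<lambda>i. (P + 1, P + i)) (tl js)) ts)))
           \<subseteq> {\<rho> \<circ> embed P l a | \<rho> a. \<rho> \<in> F \<and> a \<in> set c}"
    using Cons.prems(1) F(2) by (intro Cons.IH) auto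
  show ?case
    unfolding t(1) list.map concat.simps prod.case states_append Un_subset_iff block(2)
    using block(1) IH by blast
qed

text \<open>The second conjunct feeds the induction: \<open>expanded_states\<close> requires every
  push to start at the last of the \<open>k + 1\<close> slots of the new block and to reach beyond
  it.\<close>

lemma code_transitions_products:
  assumes d: "d \<ge> 1" and rs: "\<forall>r\<in>set rs. 1 < r \<and> r \<le> k"
    and aux: "auxiliary_code (k + 1) c js" and "r < d"
  shows "set (states (sigma0 k d) (code_transitions k d rs js (d - r)))
           \<subseteq> products k d (set c) (Suc r) \<and>
         (\<forall>(i, j)\<in>set (code_transitions k d rs js (d - r)). i = k * (d - r - 1) + 1 \<and> i < j)"
  using assms(4)
proof (induction r)
  case 0
  have "id \<in> sym_grp k" by (simp add: sym_grp_def permutes_id)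
  then show ?case
    using last_block_states[of id k rs "sigma0 k d" "k * (d - 1)"] rs
    by (auto simp: code_transitions.simps[of _ _ _ _ d] block_perms_def embed_id)
next
  case (Suc r)
  define m where "m = d - Suc r"
  define P where "P = k * (m - 1)"
  have m: "m \<ge> 1" "m < d" "m + 1 = d - r" using Suc.prems by (auto simp: m_def)
  have Pk: "k * (d - r - 1) = P + k"
    using m by (cases m) (auto simp: P_def m_def)
  let ?T = "code_transitions k d rs js"
  have T: "?T m = concat (map (\<lambda>(_, j).
             (P + 1, j) # map (\<lambda>i. (P + 1, P + i)) (tl js)) (?T (m + 1)))"
    using m by (subst code_transitions.simps) (simp add: P_def)
  have IH1: "set (states (sigma0 k d) (?T (m + 1))) \<subseteq> products k d (set c) (Suc r)"
    and IH2: "\<forall>(i, j)\<in>set (?T (m + 1)). i = P + (k + 1) \<and> P + (k + 1) < j"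
    using Suc.IH Suc.prems unfolding m(3) Pk by auto
  have "set (states (sigma0 k d) (?T m))
      \<subseteq> {\<rho> \<circ> embed P (k + 1) a | \<rho> a. \<rho> \<in> products k d (set c) (Suc r) \<and> a \<in> set c}"
    unfolding T using aux IH2 IH1 by (intro expanded_states) auto
  also have "\<dots> = products k d (set c) (Suc (Suc r))"
    unfolding products.simps(2)[of k d "set c" "Suc r"] using m
    by (simp add: block_perms_def P_def flip: m_def)
  finally have *: "set (states (sigma0 k d) (?T m)) \<subseteq> products k d (set c) (Suc (Suc r))" .
  have "\<forall>i\<in>set (tl js). 1 < i"
    using aux by (auto simp: auxiliary_code_def transition_seq_def in_set_conv_nth dest!: list.set_sel(2)[rotated])
  then have "\<forall>(i, j)\<in>set (?T m). i = k * (m - 1) + 1 \<and> i < j"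
    unfolding T using IH2 by (auto simp: P_def)
  with * show ?case by (simp add: m_def)
qed

lemma code_C1_subset_products:
  assumes d: "d \<ge> 1" and rs: "\<forall>r\<in>set rs. 1 < r \<and> r \<le> k"
    and aux: "auxiliary_code (k + 1) c js"
  shows "code_C1 k d rs js \<subseteq> products k d (set c) d"
  using code_transitions_products[OF d rs aux, of "d - 1"] d
    set_codewords_subset_states[of "sigma0 k d" "code_transitions k d rs js 1"]
  by (auto simp: code_C1_def)

text \<open>The quotient lies in the interval from \<open>m - 1\<close> (exclusive) to
  \<open>m\<close>, so its ceiling is \<open>m\<close>. Block \<open>m\<close> thus holds the values
  congruent to \<open>m\<close> modulo \<open>d\<close>, the smallest of them at
  \<open>u = k\<close>.\<close>

lemma sigma0_block:
  assumes "u \<in> {1..k}" "m \<in> {1..d}"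
  shows "sigma0 k d (k * (m - 1) + u) = d * (u mod k) + m"
proof -
  let ?j = "k * (m - 1) + u"
  have "k * (m - 1) + k \<le> k * d"
    using assms(2) by (metis add.commute atLeastAtMost_iff le_add_diff_inverse mult_Suc_right mult_le_mono2 plus_1_eq_Suc)
  then have mem: "?j \<in> {1..k*d}" using assms(1) by auto
  have "\<lceil>real ?j / real k\<rceil> = int m"
  proof (rule ceiling_unique)
    show "real_of_int (int m) - 1 < real ?j / real k" "real ?j / real k \<le> real_of_int (int m)"
      using assms by (auto simp: field_simps of_nat_diff)
  qed
  with mem show ?thesis by (simp add: sigma0_def)
qed

text \<open>Only the last block reaches position \<open>k*d + 1\<close>, and its factor fixes that
  slot; earlier blocks end within \<open>k*d\<close>.\<close>

lemma products_outside:
  assumes "k \<ge> 1" and A: "\<forall>a\<in>A. a permutes {1..k + 1}" and "r \<le> d"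
    and "\<rho> \<in> products k d A r" and "j \<notin> {1..k*d}"
  shows "\<rho> j = j"
  using assms(3,4)
proof (induction r arbitrary: \<rho>)
  case 0
  then show ?case using assms(5) by (auto simp: sigma0_def)
next
  case (Suc r)
  define P where "P = k * (d - r - 1)"
  obtain \<rho>' a where eq: "\<rho> = \<rho>' \<circ> embed P (k + 1) a"
    and \<rho>': "\<rho>' \<in> products k d A r" and a: "a \<in> block_perms k d A (d - r)"
    using Suc.prems(2) by (auto simp: P_def)
  have P: "P + k = k * (d - r)"
    using Suc.prems(1) unfolding P_def
    by (metis Suc_diff_Suc Suc_le_lessD diff_Suc_1 add.commute mult_Suc_right)
  have "embed P (k + 1) a j = j"
  proof (cases "r = 0")
    case True
    then have "a permutes {1..k}" using a by (simp add: block_perms_def sym_grp_def)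
    then have "a (k + 1) = k + 1" by (auto simp: permutes_def)
    moreover have "j - P = k + 1" if "j \<in> {P + 1..P + (k + 1)}"
      using that True P assms(5) by auto
    ultimately show ?thesis by (auto simp: embed_def)
  next
    case False
    have "k * (d - r) + k \<le> k * d"
      using Suc.prems(1) False by (metis add.commute diff_less less_eq_Suc_le mult_Suc_right mult_le_mono2 not_gr0 order_less_le_trans zero_less_Suc)
    then have "j \<notin> {P + 1..P + (k + 1)}" using assms(1,5) P by auto
    then show ?thesis by (auto simp: embed_def)
  qed
  with Suc.IH[OF _ \<rho>'] Suc.prems(1) show ?case by (simp add: eq)
qed

text \<open>The first \<open>r\<close> factors move only positions beyond
  \<open>k * (d - r)\<close>. In the decoder this identifies the \<open>k\<close> values that belong
  to the current block.\<close>

lemma products_initial: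
  assumes "\<rho> \<in> products k d A r" and "j \<le> k * (d - r)"
  shows "\<rho> j = sigma0 k d j"
  using assms
proof (induction r arbitrary: \<rho>)
  case (Suc r)
  then obtain \<rho>' a where eq: "\<rho> = \<rho>' \<circ> embed (k * (d - r - 1)) (k + 1) a"
    and \<rho>': "\<rho>' \<in> products k d A r" by auto
  have "k * (d - Suc r) \<le> k * (d - r)" by (intro mult_le_mono2) simp
  with Suc.prems(2) have "\<rho>' j = sigma0 k d j" by (intro Suc.IH[OF \<rho>']) linarith
  moreover have "embed (k * (d - r - 1)) (k + 1) a j = j"
    using Suc.prems(2) by (auto simp: embed_def)
  ultimately show ?case by (simp add: eq)
qed simp

section \<open>A logic for running times\<close>

lemma afits_simps [simp]:
  "afits w (Lit v) s \<longleftrightarrow> v \<le> w"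
  "afits w (Reg x) s \<longleftrightarrow> regs s x \<le> w"
  "afits w (Elem a e) s \<longleftrightarrow> arrs s a (aval e s) \<le> w \<and> afits w e s"
  "afits w (Add e f) s \<longleftrightarrow> aval e s + aval f s \<le> w \<and> afits w e s \<and> afits w f s"
  "afits w (Sub e f) s \<longleftrightarrow> aval e s - aval f s \<le> w \<and> afits w e s \<and> afits w f s"
  "afits w (Mul e f) s \<longleftrightarrow> aval e s * aval f s \<le> w \<and> afits w e s \<and> afits w f s"
  "afits w (Quot e f) s \<longleftrightarrow> aval e s div aval f s \<le> w \<and> afits w e s \<and> afits w f s"
  "afits w (Rem e f) s \<longleftrightarrow> aval e s mod aval f s \<le> w \<and> afits w e s \<and> afits w f s"
  by (auto simp: afits_def)

definition runs :: "nat \<Rightarrow> com \<Rightarrow> state \<Rightarrow> nat \<Rightarrow> (state \<Rightarrow> bool) \<Rightarrow> bool" where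
  "runs w p s B Q \<longleftrightarrow> (\<exists>T s'. exec w p s T s' \<and> T \<le> B \<and> Q s')"

lemma runsI: "exec w p s T s' \<Longrightarrow> T \<le> B \<Longrightarrow> Q s' \<Longrightarrow> runs w p s B Q"
  by (auto simp: runs_def)

lemma runs_mono:
  assumes "runs w p s B R" "B \<le> B'" "\<And>s'. R s' \<Longrightarrow> Q s'"
  shows "runs w p s B' Q"
proof -
  obtain T s' where 1: "exec w p s T s'" "T \<le> B" "R s'"
    using assms(1) by (auto simp: runs_def)
  with assms(2,3) show ?thesis by (intro runsI[OF 1(1)]) auto
qed

lemma runs_Seq:
  assumes "runs w p s B R" "\<And>s'. R s' \<Longrightarrow> runs w q s' B' Q"
  shows "runs w (Seq p q) s (B + B') Q"
proof -
  obtain T s1 where 1: "exec w p s T s1" "T \<le> B" "R s1"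
    using assms(1) by (auto simp: runs_def)
  with assms(2)[of s1] obtain T' s2 where 2: "exec w q s1 T' s2" "T' \<le> B'" "Q s2"
    by (auto simp: runs_def)
  show ?thesis
    using 1 2 by (intro runsI[OF exec.Seq[OF 1(1) 2(1)]]) auto
qed

text \<open>\<open>N\<close> bounds the iterations, and the guard is evaluated once more than the
  body, hence the factor \<open>N + 1\<close>.\<close>

lemma runs_While:
  fixes \<mu> :: "state \<Rightarrow> nat"
  assumes fits: "\<And>s. I s \<Longrightarrow> bfits w b s"
    and body: "\<And>s. I s \<Longrightarrow> bval b s \<Longrightarrow> runs w p s C (\<lambda>s'. I s' \<and> \<mu> s' < \<mu> s)"
    and "I s" "\<mu> s \<le> N"
  shows "runs w (While b p) s ((N + 1) * (C + bcost b + 1)) (\<lambda>s'. I s' \<and> \<not> bval b s')"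
  using assms(3,4)
proof (induction N arbitrary: s)
  case 0
  then have "\<not> bval b s"
    using body[of s] by (auto simp: runs_def)
  with 0 show ?case
    by (intro runsI[OF exec.While_False[OF fits]]) auto
next
  case (Suc N)
  show ?case
  proof (cases "bval b s")
    case True
    obtain T s1 where 1: "exec w p s T s1" "T \<le> C" "I s1" "\<mu> s1 < \<mu> s"
      using body[OF Suc.prems(1) True] by (auto simp: runs_def)
    with Suc.prems have "runs w (While b p) s1 ((N + 1) * (C + bcost b + 1)) (\<lambda>s'. I s' \<and> \<not> bval b s')"
      by (intro Suc.IH) auto
    then obtain T' s2 where 2: "exec w (While b p) s1 T' s2"
      "T' \<le> (N + 1) * (C + bcost b + 1)" "I s2" "\<not> bval b s2"
      by (auto simp: runs_def)
    have "exec w (While b p) s (bcost b + 1 + T + T') s2"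
      using fits[OF Suc.prems(1)] True 1(1) 2(1) by (rule exec.While_True)
    moreover have "bcost b + 1 + T + T' \<le> (Suc N + 1) * (C + bcost b + 1)"
      using 1(2) 2(2) by (simp add: algebra_simps)
    ultimately show ?thesis
      using 2(3,4) unfolding runs_def by blast
  next
    case False
    with Suc.prems show ?thesis
      by (intro runsI[OF exec.While_False[OF fits]]) auto
  qed
qed

text \<open>Meaningful for loop-free programs only; the equations for \<open>While\<close> are junk.\<close>

primrec wp :: "nat \<Rightarrow> com \<Rightarrow> state \<Rightarrow> (state \<Rightarrow> bool) \<Rightarrow> bool" where
  "wp w Skip s Q \<longleftrightarrow> Q s"
| "wp w (Assign x e) s Q \<longleftrightarrow> afits w e s \<and> Q (s\<lparr>regs := (regs s)(x := aval e s)\<rparr>)"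
| "wp w (Store a i e) s Q \<longleftrightarrow> afits w i s \<and> afits w e s \<and>
     Q (s\<lparr>arrs := (arrs s)(a := (arrs s a)(aval i s := aval e s))\<rparr>)"
| "wp w (Seq p q) s Q \<longleftrightarrow> wp w p s (\<lambda>s'. wp w q s' Q)"
| "wp w (Cond b p q) s Q \<longleftrightarrow> bfits w b s \<and> (if bval b s then wp w p s Q else wp w q s Q)"
| "wp w (While b p) s Q \<longleftrightarrow> False"

primrec max_cost :: "com \<Rightarrow> nat" where
  "max_cost Skip = 1"
| "max_cost (Assign x e) = acost e + 1"
| "max_cost (Store a i e) = acost i + acost e + 1"
| "max_cost (Seq p q) = max_cost p + max_cost q"
| "max_cost (Cond b p q) = bcost b + 1 + max (max_cost p) (max_cost q)"
| "max_cost (While b p) = 0"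

lemma wp_mono:
  assumes "wp w p s R" "\<And>s'. R s' \<Longrightarrow> Q s'"
  shows "wp w p s Q"
  using assms
proof (induction p arbitrary: s R Q)
  case (Seq p q)
  from Seq.prems(1) show ?case
    unfolding wp.simps by (rule Seq.IH(1)) (rule Seq.IH(2)[OF _ Seq.prems(2)])
qed (auto split: if_splits)

lemma runs_wp: "wp w p s Q \<Longrightarrow> runs w p s (max_cost p) Q"
proof (induction p arbitrary: s Q)
  case Skip
  then show ?case by (auto intro: runsI exec.Skip)
next
  case (Assign x e)
  then show ?case by (auto intro: runsI exec.Assign[where e = e])
next
  case (Store a i e)
  then show ?case by (auto intro: runsI exec.Store[where i = i and e = e])
next
  case (Seq p q)
  from Seq.prems have "wp w p s (\<lambda>s'. wp w q s' Q)" by simp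
  from Seq.IH(1)[OF this] show ?case
    unfolding max_cost.simps by (rule runs_Seq) (rule Seq.IH(2))
next
  case (Cond b p q)
  show ?case
  proof (cases "bval b s")
    case True
    with Cond.prems have "wp w p s Q" "bfits w b s" by simp_all
    with Cond.IH(1) obtain T s' where *: "exec w p s T s'" "T \<le> max_cost p" "Q s'"
      unfolding runs_def by blast
    then show ?thesis
      by (intro runsI[OF exec.Cond_True[OF \<open>bfits w b s\<close> True *(1)]]) auto
  next
    case False
    with Cond.prems have "wp w q s Q" "bfits w b s" by simp_all
    with Cond.IH(2) obtain T s' where *: "exec w q s T s'" "T \<le> max_cost q" "Q s'"
      unfolding runs_def by blast
    then show ?thesis
      by (intro runsI[OF exec.Cond_False[OF \<open>bfits w b s\<close> False *(1)]]) auto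
  qed
qed simp

definition frame :: "nat set \<Rightarrow> nat set \<Rightarrow> state \<Rightarrow> state \<Rightarrow> bool" where
  "frame X Y s s' \<longleftrightarrow>
     (\<forall>x. x \<notin> X \<longrightarrow> regs s' x = regs s x) \<and> (\<forall>a. a \<notin> Y \<longrightarrow> arrs s' a = arrs s a)"

lemma frame_trans: "frame X Y s s' \<Longrightarrow> frame X Y s' s'' \<Longrightarrow> frame X Y s s''"
  by (auto simp: frame_def)

lemma frame_refl: "frame X Y s s"
  by (auto simp: frame_def)

section \<open>The decoder\<close>

text \<open>\<open>Rh\<close> holds the rounding radius, \<open>RP\<close> the offset of the block,
  \<open>Rc\<close> the position of the carried value, \<open>Ri\<close> the current slot,
  \<open>Rp\<close> and \<open>Rq\<close> the slots in conflict, \<open>Rpar\<close> a parity and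
  \<open>Ru\<close> a label; \<open>Rx\<close>, \<open>Ry\<close> and \<open>Rz\<close> are
  scratch.\<close>

abbreviation (input) "Rk \<equiv> 0"
abbreviation (input) "Rd \<equiv> 1"
abbreviation (input) "Rh \<equiv> 2"
abbreviation (input) "Rm \<equiv> 3"
abbreviation (input) "RP \<equiv> 4"
abbreviation (input) "Rc \<equiv> 5"
abbreviation (input) "Ri \<equiv> 6"
abbreviation (input) "Rp \<equiv> 7"
abbreviation (input) "Rq \<equiv> 8"
abbreviation (input) "Rpar \<equiv> 9"
abbreviation (input) "Rx \<equiv> 10"
abbreviation (input) "Ry \<equiv> 11"
abbreviation (input) "Ru \<equiv> 12"
abbreviation (input) "Rz \<equiv> 13"

text \<open>Adding the radius before subtracting \<open>m\<close> turns the two-sided distance test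
  into one comparison of a remainder. The guard on \<open>Ry\<close> protects the truncated
  subtraction.\<close>

definition read_label :: com where
  "read_label =
     Seq (Cond (Equal (Reg Ri) (Lit 1)) (Assign Rx (Reg Rc)) (Assign Rx (Add (Reg RP) (Reg Ri))))
    (Seq (Assign Ry (Add (Elem 0 (Reg Rx)) (Reg Rh)))
         (Cond (Less (Reg Ry) (Reg Rm)) (Assign Ru (Lit 0))
          (Seq (Assign Ry (Sub (Reg Ry) (Reg Rm)))
          (Seq (Assign Ru (Quot (Reg Ry) (Reg Rd)))
               (Cond (Conj (Less (Reg Ru) (Reg Rk))
                       (Less (Rem (Reg Ry) (Reg Rd)) (Add (Add (Reg Rh) (Reg Rh)) (Lit 1))))
                 (Cond (Equal (Reg Ru) (Lit 0)) (Assign Ru (Reg Rk)) Skip)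
                 (Assign Ru (Lit 0)))))))"

text \<open>Array 2 stores at \<open>P + u\<close> the first slot with label \<open>u\<close>.
  Different blocks use disjoint index ranges, so the array never has to be cleared.\<close>

definition mark_label :: com where
  "mark_label =
     Cond (Equal (Reg Ru) (Lit 0)) (Seq (Assign Rp (Reg Ri)) (Assign Rq (Lit 0)))
       (Seq (Assign Rz (Elem 2 (Add (Reg RP) (Reg Ru))))
         (Cond (Equal (Reg Rz) (Lit 0))
            (Store 2 (Add (Reg RP) (Reg Ru)) (Reg Ri))
            (Seq (Assign Rp (Reg Ri)) (Assign Rq (Reg Rz)))))"

text \<open>
  The output is written before it is known which of two conflicting positions belongs to the block:
  the other one receives a wrong value, which is overwritten when a later block is decoded.
\<close>

definition write_label :: com where
  "write_label =
     Seq (Store 1 (Reg Rx) (Add (Mul (Reg Rd) (Rem (Reg Ru) (Reg Rk))) (Reg Rm)))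
    (Seq (Store 3 (Reg Ri) (Reg Ru))
    (Seq (Store 4 (Reg Ri) (Reg Ru))
         (Assign Ri (Add (Reg Ri) (Lit 1)))))"

definition record_label :: com where
  "record_label = Seq mark_label write_label"

text \<open>Array 4 is a copy of the candidate, sorted by following cycles; each exchange flips
  \<open>Rpar\<close>. Array 3 keeps the candidate itself.\<close>

definition sort_step :: com where
  "sort_step =
     Cond (Equal (Elem 4 (Reg Ri)) (Reg Ri)) (Assign Ri (Add (Reg Ri) (Lit 1)))
       (Seq (Assign Rz (Elem 4 (Reg Ri)))
       (Seq (Store 4 (Reg Ri) (Elem 4 (Reg Rz)))
       (Seq (Store 4 (Reg Rz) (Reg Rz))
            (Assign Rpar (Sub (Lit 1) (Reg Rpar))))))"

text \<open>\<open>Rp\<close> must always mark the slot holding \<open>k + 1\<close>, so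
  \<open>Rp\<close> and \<open>Rq\<close> are exchanged along with the values.\<close>

definition swap_candidate :: com where
  "swap_candidate =
     Seq (Store 3 (Reg Rp) (Elem 3 (Reg Rq)))
    (Seq (Store 3 (Reg Rq) (Add (Reg Rk) (Lit 1)))
    (Seq (Assign Rz (Reg Rp))
    (Seq (Assign Rp (Reg Rq))
         (Assign Rq (Reg Rz)))))"

definition beta_test :: bexp where
  "beta_test =
     Conj (Equal (Rem (Reg Rk) (Lit 2)) (Lit 1))
    (Conj (Disj (Equal (Elem 3 (Add (Reg Rk) (Lit 1))) (Sub (Reg Rk) (Lit 2)))
                (Equal (Elem 3 (Add (Reg Rk) (Lit 1))) (Reg Rk)))
          (Disj (Equal (Elem 3 (Sub (Reg Rk) (Lit 1))) (Sub (Reg Rk) (Lit 2)))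
                (Equal (Elem 3 (Sub (Reg Rk) (Lit 1))) (Reg Rk))))"

text \<open>For \<open>k\<close> other than \<open>3\<close>, the odd candidate is first brought
  into array 3; it stays there exactly if it passes \<open>beta_test\<close>.\<close>

definition resolve :: com where
  "resolve =
     Cond (Equal (Reg Rq) (Lit 0)) Skip
       (Cond (Equal (Reg Rk) (Lit 3))
         (Cond (Equal (Elem 3 (Add (Rem (Reg Rp) (Lit 4)) (Lit 1))) (Lit 1)) Skip swap_candidate)
         (Seq (Cond (Equal (Reg Rpar) (Lit 0)) swap_candidate Skip)
              (Cond beta_test Skip swap_candidate)))"

definition begin_block :: com where
  "begin_block = Seq (Assign Ri (Lit 1)) (Seq (Assign Rp (Lit 0)) (Assign Rq (Lit 0)))"

definition begin_sort :: com where
  "begin_sort =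
     Seq (Store 3 (Reg Rp) (Add (Reg Rk) (Lit 1)))
    (Seq (Store 4 (Reg Rp) (Add (Reg Rk) (Lit 1)))
    (Seq (Assign Rpar (Lit 0))
         (Assign Ri (Lit 1))))"

text \<open>If slot \<open>1\<close> is the foreign one, the value carried in is carried on and
  \<open>Rc\<close> stays as it is.\<close>

definition end_block :: com where
  "end_block =
     Seq (Cond (Equal (Reg Rp) (Lit 1)) Skip (Assign Rc (Add (Reg RP) (Reg Rp))))
    (Seq (Assign RP (Add (Reg RP) (Reg Rk)))
         (Assign Rm (Add (Reg Rm) (Lit 1))))"

definition in_block :: bexp where
  "in_block = Less (Reg Ri) (Add (Reg Rk) (Lit 2))"

definition decode_block :: com where
  "decode_block =
     Seq begin_block
    (Seq (While in_block (Seq read_label record_label))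
    (Seq begin_sort
    (Seq (While in_block sort_step)
    (Seq resolve end_block))))"

definition decoder :: com where
  "decoder =
     Seq (Seq (Assign Rh (Quot (Sub (Reg Rd) (Lit 1)) (Lit 2)))
         (Seq (Assign Rm (Lit 1)) (Assign Rc (Lit 1))))
       (While (Less (Reg Rm) (Add (Reg Rd) (Lit 1))) decode_block)"

subsection \<open>Rounding\<close>

text \<open>The label \<open>0\<close> means that no value of class \<open>m\<close> is close to \<open>y\<close>.\<close>

definition label :: "nat \<Rightarrow> nat \<Rightarrow> nat \<Rightarrow> nat \<Rightarrow> nat" where
  "label k d m y =
     (let h = (d - 1) div 2; z = y + h - m in
      if y + h < m then 0
      else if z div d < k \<and> z mod d < h + h + 1 then (if z div d = 0 then k else z div d)
      else 0)"

lemma label_le: "label k d m y \<le> k"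
  by (auto simp: label_def Let_def)

text \<open>The shifted entry is \<open>d * e + r\<close> with \<open>r\<close> at most twice the
  radius, hence below \<open>d\<close>. So division by \<open>d\<close> recovers \<open>e\<close>,
  where \<open>e = 0\<close> stands for \<open>u = k\<close>.\<close>

lemma label_eqI:
  assumes "u \<in> {1..k}" "m \<ge> 1" "d \<ge> 1"
    and "\<bar>int (d * (u mod k) + m) - int y\<bar> \<le> int ((d - 1) div 2)"
  shows "label k d m y = u"
proof -
  define h where "h = (d - 1) div 2"
  define e where "e = u mod k"
  have h: "h + h < d" using assms(3) by (simp add: h_def)
  have ge: "d * e + m \<le> y + h" and le: "y \<le> d * e + m + h"
    using assms(4) unfolding h_def[symmetric] e_def[symmetric] by linarith+
  define r where "r = y + h - m - d * e"
  have r: "y + h - m = d * e + r" "r < h + h + 1" "r < d"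
    using ge le h by (auto simp: r_def)
  have "e < k" using assms(1) by (simp add: e_def)
  moreover have "(if e = 0 then k else e) = u"
    using assms(1) by (cases "u = k") (auto simp: e_def)
  ultimately show ?thesis
    using ge r unfolding label_def Let_def h_def[symmetric] by auto
qed

lemma permutation_of_interval: "b permutes {1..l::nat} \<Longrightarrow> permutation b"
  using permutation_permutes finite_atLeastAtMost by blast

locale block =
  fixes k d m c n P h w :: nat and inp out :: "nat \<Rightarrow> nat"
  assumes k: "k \<ge> 2" and d: "d \<ge> 1" and m: "m \<in> {1..d}"
    and n: "n = k * d" and P: "P = k * (m - 1)" and h: "h = (d - 1) div 2"
    and c: "c \<in> {1..P + 1}"
    and inp: "\<And>j. inp j \<le> n" and w: "8 * n + 16 \<le> w"
begin

text \<open>Slot \<open>1\<close> may lie in an earlier block, namely where the carried value was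
  left; in the first block \<open>c = P + 1\<close>.\<close>

definition pos :: "nat \<Rightarrow> nat" where
  "pos i = (if i = 1 then c else P + i)"

definition f :: "nat \<Rightarrow> nat" where
  "f i = label k d m (inp (pos i))"

lemma bounds: "P + k \<le> n" "m \<le> n" "d \<le> n" "k \<le> n" "h \<le> n" "m \<le> d" "c \<le> n + 1"
proof -
  show "P + k \<le> n"
    unfolding n P
    using m by (metis add.commute atLeastAtMost_iff le_add_diff_inverse mult_Suc_right mult_le_mono2 plus_1_eq_Suc)
  then show "c \<le> n + 1" using c by auto
  show "d \<le> n" "k \<le> n" using k d by (auto simp: n)
  moreover show "m \<le> d" using m by simp
  moreover have "h \<le> d" unfolding h by linarith
  ultimately show "m \<le> n" "h \<le> n" by linarith+
qed

lemma f_le: "f i \<le> k"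
  by (simp add: f_def label_le)

lemma pos_inj: "inj_on pos {1..k + 1}"
  using c by (auto simp: inj_on_def pos_def)

definition params :: "state \<Rightarrow> bool" where
  "params s \<longleftrightarrow> regs s Rk = k \<and> regs s Rd = d \<and> regs s Rh = h \<and> regs s Rm = m \<and>
     regs s RP = P \<and> regs s Rc = c \<and> arrs s 0 = inp"

lemma read_label:
  assumes "params s" "regs s Ri = i" "i \<in> {1..k + 1}"
  shows "wp w read_label s (\<lambda>s'. frame {Rx, Ry, Ru} {} s s' \<and> regs s' Rx = pos i \<and> regs s' Ru = f i)"
proof -
  define y where "y = inp (pos i)"
  define z where "z = y + h - m"
  define e where "e = z div d"
  define r where "r = z mod d"
  have yn: "y \<le> n" using inp by (simp add: y_def)
  have "e \<le> z" "r \<le> z" by (auto simp: e_def r_def)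
  moreover have "z \<le> y + h" by (simp add: z_def)
  ultimately have "y + h \<le> w" "z \<le> w" "e \<le> w" "r \<le> w"
    using yn bounds w by linarith+
  moreover have "h \<le> w" "m \<le> w" "d \<le> w" "k \<le> w" "P + i \<le> w" "c \<le> w" "y \<le> w" "h + h \<le> w"
    "h + h + 1 \<le> w" "1 \<le> w" "i \<le> w" "P \<le> w"
    using yn bounds w assms(3) by auto
  ultimately have fits: "(y + h \<le> w) = True" "(z \<le> w) = True" "(e \<le> w) = True" "(r \<le> w) = True"
    "(h \<le> w) = True" "(m \<le> w) = True" "(d \<le> w) = True" "(k \<le> w) = True" "(P + i \<le> w) = True"
    "(c \<le> w) = True" "(y \<le> w) = True" "(h + h \<le> w) = True" "(h + h + 1 \<le> w) = True"
    "(1 \<le> w) = True" "(i \<le> w) = True" "(P \<le> w) = True" "(0 \<le> w) = True"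
    by (simp_all only: simp_thms le0)
  have s: "regs s 0 = k" "regs s 1 = d" "regs s 2 = h" "regs s 3 = m"
    "regs s 4 = P" "regs s 5 = c" "arrs s 0 = inp" "regs s 6 = i"
    using assms by (auto simp: params_def)
  have f: "f i = (if y + h < m then 0 else if e < k \<and> r < h + h + 1 then (if e = 0 then k else e) else 0)"
    unfolding e_def r_def z_def y_def f_def label_def Let_def h ..
  have x: "wp w (Cond (Equal (Reg Ri) (Lit 1)) (Assign Rx (Reg Rc)) (Assign Rx (Add (Reg RP) (Reg Ri)))) s
      (\<lambda>s'. s' = s\<lparr>regs := (regs s)(Rx := pos i)\<rparr>)"
    by (simp add: s fits pos_def del: One_nat_def)
  show ?thesis
    unfolding read_label_def
  proof (subst wp.simps(4), rule wp_mono[OF x])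
    fix s'
    assume "s' = s\<lparr>regs := (regs s)(Rx := pos i)\<rparr>"
    then have s': "regs s' 0 = k" "regs s' 1 = d" "regs s' 2 = h" "regs s' 3 = m" "regs s' 10 = pos i"
      "arrs s' 0 (pos i) = y" "(pos i \<le> w) = True" and fr: "frame {Rx, Ry, Ru} {} s s'"
      using s fits by (simp_all add: y_def frame_def pos_def del: One_nat_def)
    show "wp w (Seq (Assign Ry (Add (Elem 0 (Reg Rx)) (Reg Rh)))
         (Cond (Less (Reg Ry) (Reg Rm)) (Assign Ru (Lit 0))
          (Seq (Assign Ry (Sub (Reg Ry) (Reg Rm)))
          (Seq (Assign Ru (Quot (Reg Ry) (Reg Rd)))
               (Cond (Conj (Less (Reg Ru) (Reg Rk))
                       (Less (Rem (Reg Ry) (Reg Rd)) (Add (Add (Reg Rh) (Reg Rh)) (Lit 1))))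
                 (Cond (Equal (Reg Ru) (Lit 0)) (Assign Ru (Reg Rk)) Skip)
                 (Assign Ru (Lit 0))))))) s'
      (\<lambda>s''. frame {Rx, Ry, Ru} {} s s'' \<and> regs s'' Rx = pos i \<and> regs s'' Ru = f i)"
      (is "wp w ?rest s' _")
    proof (rule wp_mono)
      show "wp w ?rest s' (\<lambda>s''. frame {Rx, Ry, Ru} {} s' s'' \<and> regs s'' Rx = pos i \<and> regs s'' Ru = f i)"
        unfolding f by (simp add: s' fits frame_def del: One_nat_def flip: z_def e_def r_def)
    qed (use frame_trans[OF fr] in blast)
  qed
qed

subsection \<open>Scanning a block\<close>

text \<open>
  Among \<open>k + 1\<close> positions with at most \<open>k\<close> labels, some position \<open>p\<close> either has no label
  (\<open>q = 0\<close>) or the same label as another position \<open>q\<close>.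
\<close>

definition event :: "nat \<Rightarrow> nat \<Rightarrow> nat \<Rightarrow> bool" where
  "event i p q \<longleftrightarrow>
     (if p = 0 then q = 0 \<and> (\<forall>j\<in>{1..<i}. f j \<noteq> 0) \<and> inj_on f {1..<i}
      else p \<in> {1..<i} \<and>
        (if q = 0 then f p = 0 else q \<in> {1..<i} \<and> q \<noteq> p \<and> f q = f p \<and> f p \<noteq> 0))"

text \<open>A partial inverse of the labelling, with \<open>0\<close> for an absent slot. The zeros
  past \<open>P + k\<close> are fresh entries for later blocks.\<close>

definition placed :: "nat \<Rightarrow> (nat \<Rightarrow> nat) \<Rightarrow> bool" where
  "placed i g \<longleftrightarrow>
     (\<forall>u\<in>{1..k}. g (P + u) < i \<and> (g (P + u) \<noteq> 0 \<longrightarrow> f (g (P + u)) = u)) \<and>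
     (\<forall>j\<in>{1..<i}. f j \<noteq> 0 \<longrightarrow> g (P + f j) \<noteq> 0) \<and> (\<forall>j>P + k. g j = 0)"

definition scanned :: "nat \<Rightarrow> state \<Rightarrow> bool" where
  "scanned i s \<longleftrightarrow> params s \<and> regs s Ri = i \<and> event i (regs s Rp) (regs s Rq) \<and>
     placed i (arrs s 2) \<and>
     (\<forall>j\<in>{1..<i}. arrs s 3 j = f j \<and> arrs s 4 j = f j \<and> arrs s 1 (pos j) = d * (f j mod k) + m) \<and>
     (\<forall>j. j \<notin> pos ` {1..<i} \<longrightarrow> arrs s 1 j = out j)"

lemma event_fresh:
  assumes "event i p q" "placed i g" "f i \<noteq> 0" "g (P + f i) = 0" "i \<ge> 1"
  shows "event (i + 1) p q"
proof -
  have "f i \<noteq> f j" if "j \<in> {1..<i}" for j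
    using assms that by (force simp: placed_def)
  then have "f i \<notin> f ` {1..<i}" by blast
  moreover have "{1..<i + 1} = insert i {1..<i}" using assms(5) by auto
  ultimately show ?thesis
    using assms unfolding event_def by (cases "p = 0") (auto split: if_splits)
qed

lemma placed_keep:
  assumes "placed i g" "f i = 0 \<or> g (P + f i) \<noteq> 0"
  shows "placed (i + 1) g"
  using assms by (auto simp: placed_def less_Suc_eq)

lemma placed_fresh:
  assumes "placed i g" "f i \<noteq> 0" "g (P + f i) = 0" "i \<ge> 1"
  shows "placed (i + 1) (g(P + f i := i))"
  using assms f_le[of i] by (auto simp: placed_def less_Suc_eq)

lemma value_bound: "d * (u mod k) + m \<le> n"
proof -
  have "u mod k + 1 \<le> k" using k by (simp add: Suc_leI)
  then have "d * (u mod k + 1) \<le> d * k" by (rule mult_le_mono2)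
  then show ?thesis using bounds(6) by (simp add: n mult.commute)
qed

lemma pos_bound: "i \<le> k + 1 \<Longrightarrow> pos i \<le> n + 1"
  using bounds by (auto simp: pos_def)

lemma scan_step:
  assumes s: "scanned i s" and i: "i \<in> {1..k + 1}"
  shows "wp w (Seq read_label record_label) s (scanned (i + 1))"
  unfolding wp.simps
proof (rule wp_mono[OF read_label])
  show "params s" "regs s Ri = i" "i \<in> {1..k + 1}"
    using assms by (auto simp: scanned_def)
  fix s1
  assume s1: "frame {Rx, Ry, Ru} {} s s1 \<and> regs s1 Rx = pos i \<and> regs s1 Ru = f i"
  let ?u = "f i" and ?v = "d * (f i mod k) + m" and ?g = "arrs s 2"
  have regs: "regs s1 Rk = k" "regs s1 Rd = d" "regs s1 Rh = h" "regs s1 Rm = m"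
    "regs s1 RP = P" "regs s1 Rc = c" "regs s1 Ri = i" "regs s1 Rx = pos i" "regs s1 Ru = ?u"
    and keep: "regs s1 Rp = regs s Rp" "regs s1 Rq = regs s Rq" "arrs s1 = arrs s"
    and inp0: "arrs s 0 = inp"
    using s1 s by (auto simp: scanned_def params_def frame_def)
  have ev: "event i (regs s Rp) (regs s Rq)" and pl: "placed i ?g"
    using s by (auto simp: scanned_def)
  have g: "?g (P + ?u) < i" "?g (P + ?u) \<noteq> 0 \<longrightarrow> f (?g (P + ?u)) = ?u" if "?u \<noteq> 0"
    using pl f_le[of i] that by (auto simp: placed_def)
  have "?u mod k \<le> ?u" by simp
  then have "?u mod k \<le> w" using f_le[of i] bounds w by linarith
  then have le: "?u mod k \<le> w" "?u \<le> w" "d * (?u mod k) \<le> w" "?v \<le> w" "P + ?u \<le> w" "P \<le> w" "i + 1 \<le> w"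
    "i \<le> w" "pos i \<le> w" "k \<le> w" "d \<le> w" "m \<le> w" "1 \<le> w" "0 \<le> w"
    using f_le[of i] i bounds w value_bound[of ?u] pos_bound[of i] by auto
  have gw: "?g (P + ?u) \<le> w" if "?u \<noteq> 0" using g(1)[OF that] le by linarith
  have sets: "{1..<i + 1} = insert i {1..<i}" using i by auto
  have pos: "pos j \<noteq> pos i" if "j \<in> {1..<i}" for j
    using inj_onD[OF pos_inj, of j i] that i by auto
  have old: "arrs s 3 j = f j" "arrs s 4 j = f j" "arrs s 1 (pos j) = d * (f j mod k) + m"
    if "j \<in> {1..<i}" for j
    using s that by (auto simp: scanned_def)
  have oldout: "arrs s 1 j = out j" if "j \<notin> pos ` {1..<i}" for j
    using s that by (auto simp: scanned_def)
  have arrays: "(\<forall>j\<in>{1..<i + 1}. ((arrs s 3)(i := ?u)) j = f j \<and> ((arrs s 4)(i := ?u)) j = f j \<and>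
      ((arrs s 1)(pos i := ?v)) (pos j) = d * (f j mod k) + m) \<and>
     (\<forall>j. j \<notin> pos ` {1..<i + 1} \<longrightarrow> ((arrs s 1)(pos i := ?v)) j = out j)"
    unfolding sets using old oldout pos by auto
  \<comment> \<open>Writing the label is common to the three outcomes of marking; \<open>s2\<close>
    stands for the state left by any of them.\<close>
  have tail: "wp w write_label s2 (scanned (i + 1))"
    if s2: "frame {Rp, Rq, Rz} {2} s1 s2"
      and ev2: "event (i + 1) (regs s2 Rp) (regs s2 Rq)" and pl2: "placed (i + 1) (arrs s2 2)" for s2
  proof -
    have r2: "regs s2 0 = k" "regs s2 1 = d" "regs s2 2 = h" "regs s2 3 = m"
      "regs s2 4 = P" "regs s2 5 = c" "regs s2 6 = i" "regs s2 10 = pos i" "regs s2 12 = ?u"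
      and a2: "arrs s2 0 = inp" "arrs s2 1 = arrs s 1" "arrs s2 3 = arrs s 3" "arrs s2 4 = arrs s 4"
      using s2 regs keep inp0 by (auto simp: frame_def)
    show ?thesis
      using arrays ev2 pl2 le
      by (simp add: write_label_def r2 a2 scanned_def params_def fun_upd_same fun_upd_other
          del: fun_upd_apply One_nat_def)
  qed
  have r1: "regs s1 12 = ?u" "regs s1 4 = P" "regs s1 6 = i" using regs by auto
  consider (zero) "?u = 0" | (fresh) "?u \<noteq> 0" "?g (P + ?u) = 0" | (conflict) "?u \<noteq> 0" "?g (P + ?u) \<noteq> 0"
    by blast
  then show "wp w record_label s1 (scanned (i + 1))"
  proof cases
    case zero
    then have "event (i + 1) i 0" using i by (auto simp: event_def)
    then have "wp w write_label (s1\<lparr>regs := (regs s1)(Rp := i, Rq := 0)\<rparr>) (scanned (i + 1))"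
      using placed_keep[OF pl] zero keep by (intro tail) (simp_all add: frame_def)
    with zero le show ?thesis
      by (simp add: record_label_def mark_label_def r1)
  next
    case fresh
    have "wp w write_label (s1\<lparr>regs := (regs s1)(Rz := 0), arrs := (arrs s1)(2 := ?g(P + ?u := i))\<rparr>) (scanned (i + 1))"
      using event_fresh[OF ev pl fresh] placed_fresh[OF pl fresh] i keep
      by (intro tail) (simp_all add: frame_def)
    with fresh le gw show ?thesis
      by (simp add: record_label_def mark_label_def r1 keep)
  next
    case conflict
    let ?z = "?g (P + ?u)"
    from conflict g i have "event (i + 1) i ?z" by (auto simp: event_def)
    then have "wp w write_label (s1\<lparr>regs := (regs s1)(Rz := ?z, Rp := i, Rq := ?z)\<rparr>) (scanned (i + 1))"
      using placed_keep[OF pl] conflict keep by (intro tail) (simp_all add: frame_def)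
    with conflict le gw show ?thesis
      by (simp add: record_label_def mark_label_def r1 keep)
  qed
qed

lemma scan_loop:
  assumes "scanned 1 s"
  shows "runs w (While in_block (Seq read_label record_label)) s
           ((k + 2) * (max_cost (Seq read_label record_label) + bcost in_block + 1)) (scanned (k + 2))"
proof -
  let ?I = "\<lambda>s. \<exists>i\<in>{1..k + 2}. scanned i s"
  have fits: "bfits w in_block s" if "?I s" for s
    using that w bounds by (auto simp: in_block_def scanned_def params_def)
  have cond: "bval in_block s \<longleftrightarrow> i < k + 2" if "scanned i s" for i s
    using that by (simp add: in_block_def scanned_def params_def)
  have "runs w (While in_block (Seq read_label record_label)) s
      ((k + 1 + 1) * (max_cost (Seq read_label record_label) + bcost in_block + 1))
      (\<lambda>s. ?I s \<and> \<not> bval in_block s)"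
  proof (rule runs_While[where \<mu> = "\<lambda>s. k + 2 - regs s Ri"])
    fix s
    assume "?I s" and b: "bval in_block s"
    then obtain i where i: "i \<in> {1..k + 2}" "scanned i s" by blast
    with cond b have "i \<in> {1..k + 1}" by auto
    from runs_wp[OF scan_step[OF i(2) this]]
    show "runs w (Seq read_label record_label) s (max_cost (Seq read_label record_label))
        (\<lambda>s'. ?I s' \<and> k + 2 - regs s' Ri < k + 2 - regs s Ri)"
    proof (rule runs_mono)
      fix s' assume "scanned (i + 1) s'"
      then show "?I s' \<and> k + 2 - regs s' Ri < k + 2 - regs s Ri"
        using i \<open>i \<in> {1..k + 1}\<close> by (auto simp: scanned_def)
    qed simp
  qed (use assms fits in \<open>auto simp: scanned_def\<close>)
  then show ?thesis
    by (rule runs_mono) (use cond in auto)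
qed

text \<open>Pigeonhole: otherwise the \<open>k + 1\<close> slots would have distinct labels in
  \<open>{1..k}\<close>.\<close>

lemma event_final:
  assumes "event (k + 2) p q"
  shows "p \<in> {1..k + 1}"
proof (rule ccontr)
  assume "p \<notin> {1..k + 1}"
  with assms have "p = 0" by (auto simp: event_def split: if_splits)
  with assms have "inj_on f {1..k + 1}" "\<forall>j\<in>{1..k + 1}. f j \<noteq> 0"
    by (auto simp: event_def atLeastLessThanSuc_atLeastAtMost)
  then have "card {1..k + 1} \<le> card {1..k}"
    using f_le by (intro card_inj_on_le[of f]) (auto simp: Suc_le_eq)
  then show False by simp
qed

subsection \<open>Parity by sorting\<close>

text \<open>
  Each swap puts at least one entry in its place, so sorting in place takes linearly many steps.
\<close>

definition clip :: "(nat \<Rightarrow> nat) \<Rightarrow> nat \<Rightarrow> nat" where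
  "clip g j = (if j \<in> {1..k + 1} then g j else j)"

text \<open>\<open>s0\<close> is the state before sorting and \<open>b\<close> the permutation whose
  parity is sought; \<open>Rpar\<close> counts the exchanges modulo 2.\<close>

definition sorting :: "(nat \<Rightarrow> nat) \<Rightarrow> state \<Rightarrow> state \<Rightarrow> bool" where
  "sorting b s0 s \<longleftrightarrow> params s0 \<and> frame {Ri, Rz, Rpar} {4} s0 s \<and> regs s Ri \<in> {1..k + 2} \<and>
     regs s Rpar \<le> 1 \<and> clip (arrs s 4) permutes {1..k + 1} \<and>
     (evenperm (clip (arrs s 4)) \<longleftrightarrow> (evenperm b \<longleftrightarrow> regs s Rpar = 0)) \<and>
     (\<forall>j\<in>{1..<regs s Ri}. arrs s 4 j = j)"

definition unsorted :: "state \<Rightarrow> nat" where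
  "unsorted s = (k + 2 - regs s Ri) + card {j \<in> {1..k + 1}. arrs s 4 j \<noteq> j}"

lemma sort_step:
  assumes s: "sorting b s0 s" and i: "regs s Ri \<le> k + 1"
  shows "wp w sort_step s (\<lambda>s'. sorting b s0 s' \<and> unsorted s' < unsorted s)"
proof -
  define i where "i = regs s Ri"
  define g where "g = arrs s 4"
  define z where "z = g i"
  have i1: "i \<in> {1..k + 1}" using s i by (auto simp: sorting_def i_def)
  have perm: "clip g permutes {1..k + 1}"
    and par: "evenperm (clip g) \<longleftrightarrow> (evenperm b \<longleftrightarrow> regs s Rpar = 0)" "regs s Rpar \<le> 1"
    and low: "\<forall>j\<in>{1..<i}. g j = j" and fr: "params s0" "frame {Ri, Rz, Rpar} {4} s0 s"
    using s by (auto simp: sorting_def g_def i_def)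
  have "clip g i \<in> {1..k + 1}" using perm i1 by (simp only: permutes_in_image)
  then have z1: "z \<in> {1..k + 1}" using i1 by (simp add: clip_def z_def)
  have "clip g z \<in> {1..k + 1}" using perm z1 by (simp only: permutes_in_image)
  then have gz: "g z \<in> {1..k + 1}" using z1 by (simp add: clip_def)
  have le: "i + 1 \<le> w" "i \<le> w" "z \<le> w" "g z \<le> w" "1 \<le> w" "1 - regs s Rpar \<le> w"
    "regs s Rpar \<le> w"
    using i1 z1 gz bounds w par by auto
  show ?thesis
  proof (cases "z = i")
    case True
    have "\<forall>j\<in>{1..<i + 1}. g j = j"
      using low True by (auto simp: z_def less_Suc_eq)
    then show ?thesis
      using True le i1 perm par fr
      by (auto simp: sort_step_def sorting_def unsorted_def frame_def
          simp flip: i_def g_def z_def intro!: diff_less_mono2)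
  next
    case False
    define g' where "g' = g(i := g z, z := z)"
    have "clip g z \<noteq> clip g i"
      using False permutes_inj[OF perm] by (auto dest: injD)
    then have gzz: "g z \<noteq> z" using i1 z1 by (simp add: clip_def z_def)
    have clip: "clip g' = clip g \<circ> transpose i z"
      using i1 z1 by (auto simp: fun_eq_iff clip_def g'_def transpose_def z_def)
    have tr: "transpose i z permutes {1..k + 1}"
      using i1 z1 by (intro permutes_swap_id)
    have perm': "clip g' permutes {1..k + 1}"
      unfolding clip by (rule permutes_compose[OF tr perm])
    have "evenperm (clip g') \<longleftrightarrow> evenperm (clip g) = evenperm (transpose i z)"
      unfolding clip
      by (rule evenperm_comp[OF permutation_of_interval[OF perm] permutation_swap_id])
    then have par': "evenperm (clip g') \<longleftrightarrow> (evenperm b \<longleftrightarrow> 1 - regs s Rpar = 0)"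
      using False par by (auto simp: evenperm_swap)
    \<comment> \<open>Slot \<open>z\<close> is now in place, and slot \<open>i\<close> was misplaced
      before, so no new misplaced slot arises.\<close>
    have "{j \<in> {1..k + 1}. g' j \<noteq> j} \<subseteq> {j \<in> {1..k + 1}. g j \<noteq> j} - {z}"
      using False by (auto simp: g'_def z_def split: if_splits)
    then have "card {j \<in> {1..k + 1}. g' j \<noteq> j} \<le> card ({j \<in> {1..k + 1}. g j \<noteq> j} - {z})"
      by (intro card_mono) auto
    also have "\<dots> < card {j \<in> {1..k + 1}. g j \<noteq> j}"
      using gzz z1 by (intro card_Diff1_less) auto
    finally have card: "card {j \<in> {1..k + 1}. g' j \<noteq> j} < card {j \<in> {1..k + 1}. g j \<noteq> j}" .
    have low': "\<forall>j\<in>{1..<i}. g' j = j"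
      using low by (auto simp: g'_def)
    have "sorting b s0 (s\<lparr>arrs := (arrs s)(4 := g'),
          regs := (regs s)(Rz := z, Rpar := 1 - regs s Rpar)\<rparr>)"
      using fr perm' par' low' i1 by (auto simp: sorting_def frame_def simp flip: i_def)
    moreover have "unsorted (s\<lparr>arrs := (arrs s)(4 := g'),
          regs := (regs s)(Rz := z, Rpar := 1 - regs s Rpar)\<rparr>) < unsorted s"
      using card by (simp add: unsorted_def flip: g_def)
    ultimately show ?thesis
      using False le by (simp add: sort_step_def g'_def flip: i_def g_def z_def)
  qed
qed

lemma sort_loop:
  assumes "sorting b s0 s"
  shows "runs w (While in_block sort_step) s
           ((2 * k + 4) * (max_cost sort_step + bcost in_block + 1))
           (\<lambda>s'. frame {Ri, Rz, Rpar} {4} s0 s' \<and> (evenperm b \<longleftrightarrow> regs s' Rpar = 0) \<and> regs s' Rpar \<le> 1)"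
proof -
  have s: "regs s Rk = k" "regs s Ri \<in> {1..k + 2}" if "sorting b s0 s" for s
    using that by (auto simp: sorting_def params_def frame_def)
  have fits: "bfits w in_block s" if "sorting b s0 s" for s
    using s[OF that] w bounds by (auto simp: in_block_def)
  have cond: "bval in_block s \<longleftrightarrow> regs s Ri < k + 2" if "sorting b s0 s" for s
    using s[OF that] by (simp add: in_block_def)
  have "card {j \<in> {1..k + 1}. arrs s 4 j \<noteq> j} \<le> card {1..k + 1}"
    by (intro card_mono) auto
  then have "unsorted s \<le> 2 * k + 3"
    by (simp add: unsorted_def)
  have "runs w (While in_block sort_step) s
      ((2 * k + 3 + 1) * (max_cost sort_step + bcost in_block + 1))
      (\<lambda>s. sorting b s0 s \<and> \<not> bval in_block s)"
  proof (rule runs_While[where \<mu> = unsorted])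
    fix s
    assume "sorting b s0 s" "bval in_block s"
    then show "runs w sort_step s (max_cost sort_step)
        (\<lambda>s'. sorting b s0 s' \<and> unsorted s' < unsorted s)"
      using cond by (intro runs_wp sort_step) auto
  next
    show "unsorted s \<le> 2 * k + 3" using \<open>unsorted s \<le> 2 * k + 3\<close> by simp
  qed (use assms fits in auto)
  then show ?thesis
  proof (rule runs_mono)
    fix s'
    assume s': "sorting b s0 s' \<and> \<not> bval in_block s'"
    \<comment> \<open>The array has become the identity, which is even, so \<open>Rpar\<close> alone
      gives the parity of \<open>b\<close>.\<close>
    then have "regs s' Ri = k + 2" using cond s by fastforce
    with s' have "clip (arrs s' 4) = id"
      by (auto simp: fun_eq_iff clip_def sorting_def)
    with s' show "frame {Ri, Rz, Rpar} {4} s0 s' \<and> (evenperm b \<longleftrightarrow> regs s' Rpar = 0) \<and> regs s' Rpar \<le> 1"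
      by (auto simp: sorting_def)
  qed simp
qed

subsection \<open>Resolving the ambiguity\<close>

definition candidate :: "(nat \<Rightarrow> nat) \<Rightarrow> state \<Rightarrow> bool" where
  "candidate b s \<longleftrightarrow> b permutes {1..k + 1} \<and> (\<forall>j\<in>{1..k + 1}. arrs s 3 j = b j) \<and>
     regs s Rp \<in> {1..k + 1} \<and> regs s Rq \<in> {1..k + 1} \<and> b (regs s Rp) = k + 1 \<and>
     regs s Rp \<noteq> regs s Rq \<and> regs s Rk = k"

abbreviation "other b v \<equiv> transpose v (k + 1) \<circ> b"

lemma swap_candidate:
  assumes b: "candidate b s" and v: "v = b (regs s Rq)"
  shows "wp w swap_candidate s
    (\<lambda>s'. candidate (other b v) s' \<and> frame {Rp, Rq, Rz} {3} s s' \<and>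
      regs s' Rp = regs s Rq \<and> regs s' Rq = regs s Rp \<and> other b v (regs s Rp) = v)"
proof -
  define p where "p = regs s Rp"
  define q where "q = regs s Rq"
  have perm: "b permutes {1..k + 1}" and A: "\<forall>j\<in>{1..k + 1}. arrs s 3 j = b j"
    and pq: "p \<in> {1..k + 1}" "q \<in> {1..k + 1}" "b p = k + 1" "p \<noteq> q" "regs s Rk = k"
    using b by (auto simp: candidate_def p_def q_def)
  have v1: "v = b q" using v by (simp add: q_def)
  have v2: "v \<in> {1..k + 1}" using permutes_in_image[OF perm] pq(2) by (simp add: v1)
  have tr: "transpose v (k + 1) permutes {1..k + 1}"
    using v2 by (intro permutes_swap_id) auto
  have perm': "other b v permutes {1..k + 1}"
    by (rule permutes_compose[OF perm tr])
  have "b j \<noteq> v" "b j \<noteq> k + 1" if "j \<noteq> p" "j \<noteq> q" for j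
    using that permutes_inj[OF perm] pq(3) v1 by (metis injD)+
  then have A': "((arrs s 3)(p := v, q := k + 1)) j = other b v j" if "j \<in> {1..k + 1}" for j
    using that A pq(3) v1 by (auto simp: transpose_def)
  have le: "p \<le> w" "q \<le> w" "v \<le> w" "k + 1 \<le> w" "k \<le> w" "1 \<le> w"
    using pq v2 bounds w by auto
  have Aq: "arrs s 3 q = v" using A pq v1 by auto
  have o: "other b v p = v" "other b v q = k + 1" using pq(3) v1 by auto
  have A'': "\<forall>j\<in>{1..k + 1}. ((arrs s 3)(p := v, q := k + 1)) j = other b v j" 
    using A' by blast
  show ?thesis
    unfolding swap_candidate_def wp.simps afits_simps aval.simps
    using perm' A'' pq le Aq o
    by (simp add: candidate_def frame_def del: comp_apply flip: p_def q_def)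
qed

lemma beta_test:
  assumes b: "candidate b s"
  shows "bfits w beta_test s" "bval beta_test s \<longleftrightarrow> beta_like (k + 1) b"
proof -
  have perm: "b permutes {1..k + 1}" and A: "\<forall>j\<in>{1..k + 1}. arrs s 3 j = b j"
    and Rk: "regs s Rk = k"
    using b by (auto simp: candidate_def)
  have mem: "k + 1 \<in> {1..k + 1}" "k - 1 \<in> {1..k + 1}" using k by auto
  then have A': "arrs s 3 (k + 1) = b (k + 1)" "arrs s 3 (k - 1) = b (k - 1)"
    using A by blast+
  have kw: "k + 1 \<le> w" using bounds w by linarith
  have "b (k + 1) \<le> k + 1" "b (k - 1) \<le> k + 1"
    using permutes_in_image[OF perm] mem by (metis atLeastAtMost_iff)+
  then have le: "b (k + 1) \<le> w" "b (k - 1) \<le> w"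
    using kw by (blast intro: order_trans)+
  have "k mod 2 \<le> k" by simp
  then have le': "k mod 2 \<le> w" "k - 2 \<le> w" "k - 1 \<le> w" "k \<le> w" "1 \<le> w" "2 \<le> w"
    using kw k by linarith+
  show "bfits w beta_test s"
    using le le' kw A' by (simp add: beta_test_def Rk del: One_nat_def)
  have "even (k + 1) \<longleftrightarrow> k mod 2 = 1" by presburger
  moreover have "k + 1 - 3 = k - 2" "k + 1 - 1 = k" "k + 1 - 2 = k - 1" by auto
  ultimately show "bval beta_test s \<longleftrightarrow> beta_like (k + 1) b"
    unfolding beta_like_def using A' by (simp add: beta_test_def Rk del: One_nat_def)
qed

lemma evenperm_other:
  assumes "b permutes {1..k + 1}" "v \<noteq> k + 1"
  shows "evenperm (other b v) \<longleftrightarrow> \<not> evenperm b"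
  using assms evenperm_comp[OF permutation_swap_id permutation_of_interval[OF assms(1)], of v "k + 1"]
  by (simp add: evenperm_swap)

lemma other_other: "other (other b v) v = b"
  by (simp add: fun_eq_iff)

text \<open>By injectivity \<open>p\<close> is the only possible witness, so a single array access
  decides the property.\<close>

lemma four_then_one_iff:
  assumes "b permutes {1..k + 1}" "k = 3" "p \<in> {1..k + 1}" "b p = k + 1"
  shows "four_then_one b \<longleftrightarrow> b (p mod 4 + 1) = 1"
proof -
  have p: "b p = 4" "p \<in> {1..4}" using assms(2-4) by simp_all
  have "i = p" if "b i = 4" for i
    using that p(1) permutes_inj[OF assms(1)] by (metis injD)
  with p show ?thesis
    unfolding four_then_one_def by blast
qed

text \<open>For \<open>k\<close> other than \<open>3\<close>: the candidates \<open>b\<close> and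
  \<open>other b v\<close> differ in parity. If \<open>a\<close> is odd it is
  \<open>beta_like\<close>; if \<open>a\<close> is even, its odd transpose is not. So testing the
  odd candidate settles which one is \<open>a\<close>.\<close>

lemma resolve_ambiguity:
  assumes b: "candidate b s" and v: "v = b (regs s Rq)"
    and a: "a = b \<or> a = other b v" and res: "resolvable (k + 1) a"
    and par: "evenperm b \<longleftrightarrow> regs s Rpar = 0" "regs s Rpar \<le> 1"
  shows "wp w resolve s (\<lambda>s'. frame {Rp, Rq, Rz} {3} s s' \<and> regs s' Rp \<in> {1..k + 1} \<and> a (regs s' Rp) = k + 1)"
proof -
  define p where "p = regs s Rp"
  define q where "q = regs s Rq"
  have perm: "b permutes {1..k + 1}" and A: "\<forall>j\<in>{1..k + 1}. arrs s 3 j = b j"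
    and pq: "p \<in> {1..k + 1}" "q \<in> {1..k + 1}" "b p = k + 1" "p \<noteq> q" and Rk: "regs s Rk = k"
    using b by (auto simp: candidate_def p_def q_def)
  have v1: "v = b q" using v by (simp add: q_def)
  have "v \<in> {1..k + 1}" using permutes_in_image[OF perm] pq(2) by (simp add: v1)
  moreover have "v \<noteq> k + 1" using permutes_inj[OF perm] pq v1 by (metis injD)
  ultimately have v2: "v \<in> {1..k}" "v \<noteq> k + 1" by auto
  have le: "p \<le> w" "q \<le> w" "k \<le> w" "4 \<le> w" "regs s Rpar \<le> w" "p mod 4 + 1 \<le> w"
    using pq bounds w par by auto
  let ?Q = "\<lambda>s'. frame {Rp, Rq, Rz} {3} s s' \<and> regs s' Rp \<in> {1..k + 1} \<and> a (regs s' Rp) = k + 1"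
  have skip: "?Q s" if "a = b"
    using that pq by (auto simp: frame_refl p_def)
  have swap: "wp w swap_candidate s ?Q" if "a = other b v"
    using that pq by (intro wp_mono[OF swap_candidate[OF b v]]) (auto simp: candidate_def)
  show ?thesis
  proof (cases "k = 3")
    case True
    have r: "four_then_one a" "\<not> four_then_one (other a v)"
      using res v2 True by (auto simp: resolvable_def)
    have "p mod 4 + 1 \<in> {1..k + 1}" using True by auto
    then have Ap: "arrs s 3 (p mod 4 + 1) = b (p mod 4 + 1)" "b (p mod 4 + 1) \<in> {1..k + 1}"
      using A permutes_in_image[OF perm] by blast+
    \<comment> \<open>Of the two candidates only \<open>a\<close> has \<open>1\<close> after
      \<open>4\<close>.\<close>
    have "b (p mod 4 + 1) = 1 \<longleftrightarrow> a = b"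
      using r a four_then_one_iff[OF perm True pq(1,3)] other_other[of v b] by metis
    then show ?thesis
      using skip swap a Ap le True pq w Rk unfolding resolve_def
      by (auto simp flip: p_def q_def simp del: comp_apply)
  next
    case False
    have r: "evenperm a \<or> beta_like (k + 1) a" "evenperm a \<longrightarrow> \<not> beta_like (k + 1) (other a v)"
      using res v2 False by (auto simp: resolvable_def simp del: comp_apply)
    show ?thesis
    proof (cases "regs s Rpar = 0")
      case True
      then have ev: "evenperm b" "\<not> evenperm (other b v)"
        using par evenperm_other[OF perm v2(2)] by auto
      \<comment> \<open>In \<open>s1\<close>, after the first swap, array 3 holds the odd candidate
        \<open>other b v\<close>; a second swap restores \<open>b\<close>.\<close>
      have "wp w (Cond beta_test Skip swap_candidate) s1 ?Q"
        if s1: "candidate (other b v) s1 \<and> frame {Rp, Rq, Rz} {3} s s1 \<and>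
          regs s1 Rp = regs s Rq \<and> regs s1 Rq = regs s Rp \<and> other b v (regs s Rp) = v" for s1
      proof -
        have c: "candidate (other b v) s1" and v': "v = other b v (regs s1 Rq)"
          and fr: "frame {Rp, Rq, Rz} {3} s s1"
          using s1 by (auto simp del: comp_apply)
        show ?thesis
        proof (cases "a = other b v")
          case True
          then have "beta_like (k + 1) (other b v)" using r ev by auto
          with True c fr beta_test[OF c] show ?thesis
            by (auto simp: candidate_def simp del: comp_apply)
        next
          case False
          then have "a = b" using a by simp
          then have "\<not> beta_like (k + 1) (other b v)" using r ev by auto
          moreover have "wp w swap_candidate s1 ?Q"
          proof (rule wp_mono[OF swap_candidate[OF c v']])
            fix s2
            assume s2: "candidate (other (other b v) v) s2 \<and> frame {Rp, Rq, Rz} {3} s1 s2 \<and>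
                regs s2 Rp = regs s1 Rq \<and> regs s2 Rq = regs s1 Rp \<and>
                other (other b v) v (regs s1 Rp) = v"
            then have "candidate b s2" "frame {Rp, Rq, Rz} {3} s s2"
              using fr frame_trans unfolding other_other by blast+
            then show "?Q s2" using \<open>a = b\<close> by (auto simp: candidate_def)
          qed
          ultimately show ?thesis using beta_test[OF c] by simp
        qed
      qed
      from wp_mono[OF swap_candidate[OF b v] this] show ?thesis
        using True False le pq Rk unfolding resolve_def
        by (simp flip: p_def q_def del: comp_apply)
    next
      case False
      then have ev: "\<not> evenperm b" "evenperm (other b v)"
        using par evenperm_other[OF perm v2(2)] by auto
      have "wp w (Cond beta_test Skip swap_candidate) s ?Q"
      proof (cases "a = b")
        case True
        then have "beta_like (k + 1) b" using r ev by auto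
        with True skip beta_test[OF b] show ?thesis by simp
      next
        case False
        then have "a = other b v" using a by simp
        then have "\<not> beta_like (k + 1) b" using r ev other_other[of v b] by metis
        with swap[OF \<open>a = other b v\<close>] beta_test[OF b] show ?thesis by simp
      qed
      then show ?thesis
        using \<open>k \<noteq> 3\<close> False le(1-5) pq(1,2) Rk unfolding resolve_def p_def q_def
        by (simp del: wp.simps(5) add: wp.simps(5)[where b = "Equal _ _"])
    qed
  qed
qed

subsection \<open>Decoding a block\<close>

text \<open>Exactly one slot has \<open>a i = k + 1\<close>; its label is arbitrary, all others are
  right. If this slot is \<open>p\<close>, then \<open>b = a\<close>. Otherwise \<open>p\<close> and
  \<open>q\<close> share a label, \<open>q\<close> is the foreign slot, and \<open>b\<close> is
  \<open>a\<close> with two values exchanged.\<close>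

lemma candidate_cases:
  assumes a: "a permutes {1..k + 1}" and fa': "\<forall>i\<in>{1..k + 1}. a i \<le> k \<longrightarrow> f i = a i"
    and ev: "event (k + 2) p q"
  defines "b \<equiv> clip (f(p := k + 1))"
  shows "b permutes {1..k + 1}" "b p = k + 1"
    and "q = 0 \<Longrightarrow> a p = k + 1"
    and "q \<noteq> 0 \<Longrightarrow> q \<in> {1..k + 1} \<and> q \<noteq> p \<and> (a = b \<or> a = other b (b q))"
    and "q \<noteq> 0 \<Longrightarrow> i \<in> {1..k + 1} \<Longrightarrow> f i \<noteq> 0"
proof -
  have fa: "f i = a i" if "i \<in> {1..k + 1}" "a i \<le> k" for i
    using that fa' by blast
  have p: "p \<in> {1..k + 1}" using event_final[OF ev] .
  have range: "a i \<in> {1..k + 1}" if "i \<in> {1..k + 1}" for i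
    using that permutes_in_image[OF a] by blast
  have inj: "a i = a j \<Longrightarrow> i = j" for i j
    using permutes_inj[OF a] by (auto dest: injD)
  show bp: "b p = k + 1" using p by (simp add: b_def clip_def)
  have ba: "a = b" if ap: "a p = k + 1"
  proof
    fix j
    show "a j = b j"
    proof (cases "j \<in> {1..k + 1} \<and> j \<noteq> p")
      case True
      then have "a j \<noteq> k + 1" using inj ap by metis
      then show ?thesis using range[of j] fa[of j] True by (auto simp: b_def clip_def)
    next
      case False
      then show ?thesis
        using ap bp permutes_not_in[OF a] by (auto simp: b_def clip_def)
    qed
  qed
  have zero: "a p = k + 1" if "q = 0"
  proof -
    have "f p = 0" using ev that p by (auto simp: event_def split: if_splits)
    then show ?thesis using range[OF p] fa[OF p] by (cases "a p \<le> k") auto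
  qed
  then show "q = 0 \<Longrightarrow> a p = k + 1" .
  have q: "q \<in> {1..k + 1}" "q \<noteq> p" "f q = f p" "f p \<noteq> 0" if "q \<noteq> 0"
    using ev that p by (auto simp: event_def split: if_splits)
  have ba': "a = other b (b q) \<and> b = other a (b q) \<and> a q = k + 1" if "q \<noteq> 0" "a p \<noteq> k + 1"
  proof -
    have fp: "f p = a p" "a p \<in> {1..k}" using range[OF p] fa[OF p] that(2) by auto
    \<comment> \<open>Otherwise the equal labels of \<open>p\<close> and \<open>q\<close> would both
      be true values, against injectivity of \<open>a\<close>.\<close>
    have aq: "a q = k + 1"
    proof (rule ccontr)
      assume "a q \<noteq> k + 1"
      then have "f q = a q" using range[of q] fa[of q] q[OF that(1)] by auto
      then show False using inj fp q[OF that(1)] by metis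
    qed
    have bq: "b q = a p" using q[OF that(1)] fp by (simp add: b_def clip_def)
    have "b j = other a (a p) j" for j
    proof -
      consider "j = p" | "j = q" | "j \<in> {1..k + 1} - {p, q}" | "j \<notin> {1..k + 1}" by blast
      then show ?thesis
      proof cases
        case 1
        then show ?thesis using bp by simp
      next
        case 2
        then show ?thesis using bq aq by simp
      next
        case 3
        then have "a j \<noteq> k + 1" "a j \<noteq> a p" using inj[of j p] inj[of j q] aq by auto
        with 3 range[of j] fa[of j] show ?thesis by (auto simp: b_def clip_def transpose_def)
      next
        case 4
        then have "a j = j" using permutes_not_in[OF a] by blast
        with 4 fp(2) show ?thesis by (auto simp: b_def clip_def transpose_def)
      qed
    qed
    then have b: "b = other a (b q)" unfolding bq by (rule ext)
    have "a = other (other a (b q)) (b q)" by (rule other_other[symmetric])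
    then have "a = other b (b q)" unfolding b[symmetric] .
    with b aq show ?thesis by (intro conjI)
  qed
  show "b permutes {1..k + 1}"
  proof (cases "a p = k + 1")
    case True
    then show ?thesis using ba a by simp
  next
    case False
    then have "q \<noteq> 0" using zero by blast
    note q = q[OF this] and ba' = ba'[OF this False]
    have "b q = f p" using q by (simp add: b_def clip_def)
    then have "b q \<in> {1..k + 1}" using q(4) f_le[of p] by simp
    then have "other a (b q) permutes {1..k + 1}"
      by (intro permutes_compose[OF a permutes_swap_id]) auto
    then show ?thesis using ba' by metis
  qed
  show "q \<in> {1..k + 1} \<and> q \<noteq> p \<and> (a = b \<or> a = other b (b q))" if "q \<noteq> 0"
  proof (intro conjI q[OF that])
    show "a = b \<or> a = other b (b q)"
    proof (cases "a p = k + 1")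
      case False
      from conjunct1[OF ba'[OF that False]] show ?thesis by (rule disjI2)
    qed (rule disjI1[OF ba])
  qed
  \<comment> \<open>The foreign slot is \<open>p\<close> or \<open>q\<close>, whose common label is
    nonzero; any other label is a true value. Hence a label \<open>0\<close> anywhere precludes a
    conflict.\<close>
  show "f i \<noteq> 0" if "q \<noteq> 0" "i \<in> {1..k + 1}"
  proof (cases "a i = k + 1")
    case True
    moreover have "a p = k + 1 \<or> a q = k + 1" using ba'[OF that(1)] by blast
    ultimately have "a i = a p \<or> a i = a q" by argo
    then have "i = p \<or> i = q" using inj by blast
    then show ?thesis using q[OF that(1)] by auto
  next
    case False
    then show ?thesis using range[OF that(2)] fa[OF that(2)] by auto
  qed
qed

definition block_cost :: nat where
  "block_cost = max_cost begin_block
     + ((k + 2) * (max_cost (Seq read_label record_label) + bcost in_block + 1)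
     + (max_cost begin_sort
     + ((2 * k + 4) * (max_cost sort_step + bcost in_block + 1)
     + (max_cost resolve + max_cost end_block))))"

text \<open>Only slots with \<open>a i \<le> k\<close> get a guaranteed output; what the foreign
  slot receives is left open. The second alternative for \<open>resolvable\<close> serves the last
  block.\<close>

lemma decode_block:
  assumes s: "params s" "\<forall>j>P. arrs s 2 j = 0" "arrs s 1 = out"
    and a: "a permutes {1..k + 1}" and fa: "\<forall>i\<in>{1..k + 1}. a i \<le> k \<longrightarrow> f i = a i"
    and res: "resolvable (k + 1) a \<or> (\<exists>i\<in>{1..k + 1}. f i = 0)"
  shows "runs w decode_block s block_cost (\<lambda>s'.
     regs s' Rk = k \<and> regs s' Rd = d \<and> regs s' Rh = h \<and> regs s' Rm = m + 1 \<and> regs s' RP = P + k \<and>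
     (\<exists>p\<in>{1..k + 1}. a p = k + 1 \<and> regs s' Rc = pos p) \<and> arrs s' 0 = inp \<and>
     (\<forall>j>P + k. arrs s' 2 j = 0) \<and>
     (\<forall>i\<in>{1..k + 1}. a i \<le> k \<longrightarrow> arrs s' 1 (pos i) = d * (a i mod k) + m) \<and>
     (\<forall>j. j \<notin> pos ` {1..k + 1} \<longrightarrow> arrs s' 1 j = out j))"
  (is "runs w decode_block s block_cost ?post")
  unfolding decode_block_def block_cost_def
proof (rule runs_Seq)
  have "wp w begin_block s (scanned 1)"
    using s w by (auto simp: begin_block_def scanned_def params_def event_def placed_def)
  then show "runs w begin_block s (max_cost begin_block) (scanned 1)" by (rule runs_wp)
next
  fix s1 assume "scanned 1 s1"
  then show "runs w (Seq (While in_block (Seq read_label record_label))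
      (Seq begin_sort (Seq (While in_block sort_step) (Seq resolve end_block)))) s1
     ((k + 2) * (max_cost (Seq read_label record_label) + bcost in_block + 1)
     + (max_cost begin_sort
     + ((2 * k + 4) * (max_cost sort_step + bcost in_block + 1)
     + (max_cost resolve + max_cost end_block)))) ?post"
  proof (rule runs_Seq[OF scan_loop])
    fix s2 assume s2: "scanned (k + 2) s2"
    define p where "p = regs s2 Rp"
    define q where "q = regs s2 Rq"
    define b where "b = clip (f(p := k + 1))"
    have ev: "event (k + 2) p q" and par2: "params s2" and pl: "placed (k + 2) (arrs s2 2)"
      using s2 by (auto simp: scanned_def p_def q_def)
    have p: "p \<in> {1..k + 1}" using event_final[OF ev] .
    note cand = candidate_cases[OF a fa ev, folded b_def]
    have A: "arrs s2 3 j = f j" "arrs s2 4 j = f j" "arrs s2 1 (pos j) = d * (f j mod k) + m"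
      if "j \<in> {1..k + 1}" for j
      using s2 that by (auto simp: scanned_def)
    have out2: "arrs s2 1 j = out j" if "j \<notin> pos ` {1..k + 1}" for j
      using s2 that by (auto simp: scanned_def atLeastLessThanSuc_atLeastAtMost)
    have le: "p \<le> w" "k + 1 \<le> w" "k \<le> w" "1 \<le> w"
      using p bounds w by auto
    let ?s3 = "\<lambda>s3. sorting b s3 s3 \<and> frame {Rpar, Ri} {3, 4} s2 s3 \<and>
        (\<forall>j\<in>{1..k + 1}. arrs s3 3 j = b j)"
    have "clip ((arrs s2 4)(p := k + 1)) = b"
      using A by (auto simp: fun_eq_iff clip_def b_def)
    moreover have "params s2 \<Longrightarrow> regs s2 Rk = k" by (simp add: params_def)
    moreover have "\<forall>j\<in>{1..k + 1}. ((arrs s2 3)(p := k + 1)) j = b j"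
      using A by (auto simp: clip_def b_def)
    ultimately have "wp w begin_sort s2 ?s3"
      using cand(1) par2 le
      by (simp add: begin_sort_def sorting_def frame_def params_def flip: p_def)
    from runs_wp[OF this]
    show "runs w (Seq begin_sort (Seq (While in_block sort_step) (Seq resolve end_block))) s2
      (max_cost begin_sort + ((2 * k + 4) * (max_cost sort_step + bcost in_block + 1)
     + (max_cost resolve + max_cost end_block))) ?post"
    proof (rule runs_Seq)
      fix s3 assume s3: "?s3 s3"
      then have "sorting b s3 s3" by blast
      from sort_loop[OF this]
      show "runs w (Seq (While in_block sort_step) (Seq resolve end_block)) s3
         ((2 * k + 4) * (max_cost sort_step + bcost in_block + 1)
          + (max_cost resolve + max_cost end_block)) ?post"
      proof (rule runs_Seq)
        fix s4
        assume s4: "frame {Ri, Rz, Rpar} {4} s3 s4 \<and> (evenperm b \<longleftrightarrow> regs s4 Rpar = 0) \<and> regs s4 Rpar \<le> 1"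
        have pq4: "regs s4 Rp = p" "regs s4 Rq = q" "regs s4 Rk = k"
          and A4: "\<forall>j\<in>{1..k + 1}. arrs s4 3 j = b j"
          and par4: "evenperm b \<longleftrightarrow> regs s4 Rpar = 0" "regs s4 Rpar \<le> 1"
          using s3 s4 par2 by (auto simp: frame_def p_def q_def params_def)
        have "wp w resolve s4 (\<lambda>s'. frame {Rp, Rq, Rz} {3} s4 s' \<and> regs s' Rp \<in> {1..k + 1} \<and> a (regs s' Rp) = k + 1)"
        proof (cases "q = 0")
          case True
          then show ?thesis
            using cand(3) p pq4 by (simp add: resolve_def frame_refl)
        next
          case False
          have "candidate b s4"
            using cand False p pq4 A4 by (auto simp: candidate_def)
          moreover have "a = b \<or> a = other b (b (regs s4 Rq))"
            using cand(4)[OF False] pq4 by simp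
          \<comment> \<open>In a conflict no label is \<open>0\<close>, which leaves the first
            alternative of \<open>res\<close>.\<close>
          moreover have "resolvable (k + 1) a"
            using res cand(5)[OF False] by blast
          ultimately show ?thesis
            using par4 by (intro resolve_ambiguity[OF _ refl]) auto
        qed
        from runs_wp[OF this]
        show "runs w (Seq resolve end_block) s4 (max_cost resolve + max_cost end_block) ?post"
        proof (rule runs_Seq)
          fix s5
          assume s5: "frame {Rp, Rq, Rz} {3} s4 s5 \<and> regs s5 Rp \<in> {1..k + 1} \<and> a (regs s5 Rp) = k + 1"
          define p' where "p' = regs s5 Rp"
          have p': "p' \<in> {1..k + 1}" "a p' = k + 1" using s5 by (auto simp: p'_def)
          have regs5: "regs s5 Rk = k" "regs s5 Rd = d" "regs s5 Rh = h" "regs s5 Rm = m"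
            "regs s5 RP = P" "regs s5 Rc = c" "arrs s5 0 = inp" "arrs s5 1 = arrs s2 1" "arrs s5 2 = arrs s2 2"
            using s3 s4 s5 par2 by (auto simp: frame_def params_def)
          have out5: "\<forall>i\<in>{1..k + 1}. a i \<le> k \<longrightarrow> arrs s2 1 (pos i) = d * (a i mod k) + m"
            using A(3) fa by force
          have inv5: "\<forall>j>P + k. arrs s2 2 j = 0"
            using pl by (simp add: placed_def)
          have le: "P + k \<le> w" "m + 1 \<le> w" "P + p' \<le> w" "P \<le> w" "k \<le> w" "m \<le> w" "p' \<le> w" "1 \<le> w"
            using p' bounds w by auto
          have "wp w end_block s5 ?post"
            using regs5 out5 inv5 out2 le p'
            by (auto simp: end_block_def pos_def p'_def[symmetric] intro!: bexI[of _ p'])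
          then show "runs w end_block s5 (max_cost end_block) ?post" by (rule runs_wp)
        qed
      qed
    qed
  qed
qed

end

subsection \<open>Decoding a codeword\<close>

text \<open>Apart from the two loops all costs are constants; \<open>k \<ge> 2\<close> absorbs them
  into a multiple of \<open>k\<close>.\<close>

lemma block_cost_le:
  assumes "block k d m c n P h w inp"
  shows "block.block_cost k \<le> 1000 * k"
proof -
  interpret block k d m c n P h w inp "\<lambda>_. 0" by (rule assms)
  show ?thesis
    using k
    by (simp add: block_cost_def begin_block_def read_label_def record_label_def mark_label_def write_label_def in_block_def
        begin_sort_def sort_step_def resolve_def swap_candidate_def beta_test_def end_block_def)
qed


text \<open>\<open>\<rho>\<close> is \<open>\<sigma>\<close> without the factors of the blocks
  before \<open>m\<close>: it agrees with \<open>\<sigma>\<close> past the block's first slot, into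
  which the value at \<open>c\<close> has moved. The output is right up to that slot except at
  \<open>c\<close>; at the end, \<open>c\<close> lies outside the vector.\<close>

definition decoding :: "nat \<Rightarrow> nat \<Rightarrow> (nat \<Rightarrow> nat) set \<Rightarrow> (nat \<Rightarrow> nat) \<Rightarrow> (nat \<Rightarrow> nat) \<Rightarrow>
    (nat \<Rightarrow> nat) \<Rightarrow> nat \<Rightarrow> nat \<Rightarrow> state \<Rightarrow> bool" where
  "decoding k d A \<sigma> inp \<rho> m c s \<longleftrightarrow> m \<in> {1..d + 1} \<and>
     regs s Rk = k \<and> regs s Rd = d \<and> regs s Rh = (d - 1) div 2 \<and> regs s Rm = m \<and>
     regs s RP = k * (m - 1) \<and> regs s Rc = c \<and> arrs s 0 = inp \<and>
     (\<forall>j>k * (m - 1). arrs s 2 j = 0) \<and> \<rho> \<in> products k d A (d + 1 - m) \<and>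
     c \<in> {1..k * (m - 1) + 1} \<and> \<rho> (k * (m - 1) + 1) = \<sigma> c \<and>
     (\<forall>j>k * (m - 1) + 1. \<rho> j = \<sigma> j) \<and>
     (\<forall>j\<in>{1..k * (m - 1) + 1} - {c}. arrs s 1 j = \<sigma> j) \<and> (m = d + 1 \<longrightarrow> c = k * d + 1)"

lemma decode_block_step:
  assumes k: "k \<ge> 2" and d: "d \<ge> 1" and w: "8 * (k * d) + 16 \<le> w"
    and A: "\<forall>a\<in>A. a permutes {1..k + 1} \<and> resolvable (k + 1) a"
    and input: "\<And>j. inp j \<le> k * d" "\<And>j. j > k * d \<Longrightarrow> inp j = 0"
    and near: "\<And>j. j \<in> {1..k * d} \<Longrightarrow> \<bar>int (\<sigma> j) - int (inp j)\<bar> \<le> int ((d - 1) div 2)"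
    and s: "decoding k d A \<sigma> inp \<rho> m c s" and "m \<le> d"
  shows "runs w decode_block s (1000 * k) (\<lambda>s'. \<exists>\<rho>' c'. decoding k d A \<sigma> inp \<rho>' (m + 1) c' s')"
proof -
  define P where "P = k * (m - 1)"
  define h where "h = (d - 1) div 2"
  define n where "n = k * d"
  define out where "out = arrs s 1"
  have m: "m \<in> {1..d}" and c: "c \<in> {1..P + 1}" and \<rho>: "\<rho> \<in> products k d A (d + 1 - m)"
    and \<rho>1: "\<rho> (P + 1) = \<sigma> c" and \<rho>2: "\<And>j. j > P + 1 \<Longrightarrow> \<rho> j = \<sigma> j"
    and out: "\<And>j. j \<in> {1..P + 1} - {c} \<Longrightarrow> out j = \<sigma> j"
    using s \<open>m \<le> d\<close> by (auto simp: decoding_def P_def out_def)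
  interpret block k d m c n P h w inp out
    using k d m c w input(1) by unfold_locales (auto simp: n_def P_def h_def)
  have idx: "d + 1 - m = Suc (d - m)" "d - (d - m) - 1 = m - 1" "d - (d - m) = m"
    using m by auto
  obtain \<rho>' a where \<rho>eq: "\<rho> = \<rho>' \<circ> embed P (k + 1) a"
    and \<rho>': "\<rho>' \<in> products k d A (d - m)" and a: "a \<in> block_perms k d A m"
    using \<rho> unfolding idx(1) products.simps idx(2,3) P_def by blast
  have aS: "a permutes {1..k}" if "m = d"
    using that a by (auto simp: block_perms_def sym_grp_def)
  have a_perm: "a permutes {1..k + 1}"
  proof (cases "m = d")
    case True
    show ?thesis by (rule permutes_subset[OF aS[OF True]]) auto
  next
    case False
    then show ?thesis using a A by (auto simp: block_perms_def)
  qed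
  have range: "a i \<in> {1..k + 1}" if "i \<in> {1..k + 1}" for i
    using that permutes_in_image[OF a_perm] by blast
  have Pk: "P + k = k * m"
    using m unfolding P_def by (cases m) auto
  have n_eq: "P + k = n" if "m = d" using that Pk by (simp add: n_def)
  have n_gt: "P + k + 1 \<le> n" if "m \<noteq> d"
  proof -
    have "k * (m + 1) \<le> k * d" using that m by (intro mult_le_mono2) auto
    then show ?thesis using k Pk by (simp add: n_def)
  qed
  have \<sigma>pos: "\<sigma> (pos i) = \<rho>' (P + a i)" if "i \<in> {1..k + 1}" for i
  proof -
    have "\<sigma> (pos i) = \<rho> (P + i)"
      using that \<rho>1 \<rho>2[of "P + i"] by (auto simp: pos_def)
    then show ?thesis using that by (simp add: \<rho>eq embed_def)
  qed
  \<comment> \<open>For \<open>a i \<le> k\<close> the entry still comes from \<open>sigma0\<close>,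
    hence has class \<open>m\<close>.\<close>
  have \<sigma>val: "\<sigma> (pos i) = d * (a i mod k) + m" if "i \<in> {1..k + 1}" "a i \<le> k" for i
  proof -
    have "P + a i \<le> k * (d - (d - m))"
      using that(2) Pk unfolding idx(3) by simp
    from products_initial[OF \<rho>' this] show ?thesis
      using \<sigma>pos[OF that(1)] sigma0_block[of "a i" k m d] range[OF that(1)] that(2) m
      by (simp add: P_def)
  qed
  \<comment> \<open>For \<open>m = d\<close>, slot \<open>k + 1\<close> is position
    \<open>k*d + 1\<close>, outside the vector; but there \<open>a (k + 1) = k + 1\<close>.\<close>
  have pos_n: "pos i \<in> {1..n}" if "i \<in> {1..k + 1}" "a i \<le> k" for i
  proof (cases "m = d")
    case True
    have "i \<noteq> k + 1"
      using permutes_not_in[OF aS[OF True], of "k + 1"] that(2) by auto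
    then show ?thesis using that n_eq[OF True] c by (auto simp: pos_def)
  next
    case False
    then show ?thesis using that n_gt c by (auto simp: pos_def)
  qed
  have f: "\<forall>i\<in>{1..k + 1}. a i \<le> k \<longrightarrow> f i = a i"
  proof (intro ballI impI)
    fix i assume i: "i \<in> {1..k + 1}" "a i \<le> k"
    show "f i = a i"
      unfolding f_def
      using near[of "pos i"] pos_n[OF i] range[OF i(1)] i(2) m d \<sigma>val[OF i]
      by (intro label_eqI) (auto simp: n_def)
  qed
  have res: "resolvable (k + 1) a \<or> (\<exists>i\<in>{1..k + 1}. f i = 0)"
  proof (cases "m = d")
    case True
    \<comment> \<open>Position \<open>kd + 1\<close> of the input array holds \<open>0\<close>, so that the last block, which has only
      \<open>k\<close> positions, can be treated like the others.\<close>
    have "(d - 1) div 2 < d" using d by linarith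
    then have "label k d m 0 = 0" unfolding True label_def Let_def by simp
    moreover have "inp (pos (k + 1)) = 0"
      using k n_eq[OF True] input(2) by (simp add: pos_def n_def)
    ultimately have "f (k + 1) = 0"
      unfolding f_def by simp
    then show ?thesis by (intro disjI2 bexI[of _ "k + 1"]) auto
  next
    case False
    then show ?thesis using a A by (auto simp: block_perms_def)
  qed
  have "params s"
    unfolding params_def using s by (simp add: decoding_def P_def h_def)
  moreover have "\<forall>j>P. arrs s 2 j = 0" "arrs s 1 = out"
    using s by (simp_all add: decoding_def P_def out_def)
  ultimately have "runs w decode_block s block_cost (\<lambda>s'.
     regs s' Rk = k \<and> regs s' Rd = d \<and> regs s' Rh = h \<and> regs s' Rm = m + 1 \<and> regs s' RP = P + k \<and>
     (\<exists>p\<in>{1..k + 1}. a p = k + 1 \<and> regs s' Rc = pos p) \<and> arrs s' 0 = inp \<and>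
     (\<forall>j>P + k. arrs s' 2 j = 0) \<and>
     (\<forall>i\<in>{1..k + 1}. a i \<le> k \<longrightarrow> arrs s' 1 (pos i) = d * (a i mod k) + m) \<and>
     (\<forall>j. j \<notin> pos ` {1..k + 1} \<longrightarrow> arrs s' 1 j = out j))"
    by (intro decode_block a_perm f res)
  then show ?thesis
  proof (rule runs_mono)
    show "block_cost \<le> 1000 * k"
      using block_cost_le[OF block_axioms] .
    fix s' :: state
    assume *: "regs s' Rk = k \<and> regs s' Rd = d \<and> regs s' Rh = h \<and> regs s' Rm = m + 1 \<and> regs s' RP = P + k \<and>
     (\<exists>p\<in>{1..k + 1}. a p = k + 1 \<and> regs s' Rc = pos p) \<and> arrs s' 0 = inp \<and>
     (\<forall>j>P + k. arrs s' 2 j = 0) \<and>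
     (\<forall>i\<in>{1..k + 1}. a i \<le> k \<longrightarrow> arrs s' 1 (pos i) = d * (a i mod k) + m) \<and>
     (\<forall>j. j \<notin> pos ` {1..k + 1} \<longrightarrow> arrs s' 1 j = out j)"
    then obtain p where p: "p \<in> {1..k + 1}" "a p = k + 1" "regs s' Rc = pos p" by blast
    have P': "k * (m + 1 - 1) = P + k" using Pk by simp
    have "\<rho>' (P + k + 1) = \<sigma> (pos p)"
      using \<sigma>pos[OF p(1)] p(2) by (simp add: add.assoc)
    moreover have "\<rho>' j = \<sigma> j" if "j > P + k + 1" for j
      using that \<rho>2[of j] by (auto simp: \<rho>eq embed_def)
    moreover have "pos p \<in> {1..P + k + 1}"
      using p c by (auto simp: pos_def)
    moreover have "arrs s' 1 j = \<sigma> j" if j: "j \<in> {1..P + k + 1} - {pos p}" for j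
    proof (cases "j \<in> pos ` {1..k + 1}")
      case True
      then obtain i where i: "i \<in> {1..k + 1}" "j = pos i" by blast
      with j have "i \<noteq> p" by auto
      then have "a i \<noteq> k + 1" using permutes_inj[OF a_perm] p(2) by (metis injD)
      then have "a i \<le> k" using range[OF i(1)] by auto
      then show ?thesis using * i \<sigma>val[OF i(1)] by simp
    next
      case False
      \<comment> \<open>A position that is no slot is at most \<open>P + 1\<close> and differs from
        \<open>c\<close>, so its output was already right.\<close>
      have "j \<noteq> c" using False k by (force simp: pos_def)
      moreover have "j \<le> P + 1"
      proof (rule ccontr)
        assume "\<not> j \<le> P + 1"
        then have "j = pos (j - P)" "j - P \<in> {1..k + 1}"
          using j by (auto simp: pos_def)
        with False show False by blast
      qed
      ultimately have "out j = \<sigma> j" using j out by auto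
      then show ?thesis using * False by simp
    qed
    \<comment> \<open>In the last block \<open>a\<close> fixes \<open>k + 1\<close>, so the carried
      position falls just past the vector.\<close>
    moreover have "pos p = n + 1" if "m = d"
    proof -
      have "p = k + 1"
        using p permutes_in_image[OF aS[OF that], of p] by (cases "p = k + 1") auto
      then show ?thesis using k n_eq[OF that] by (simp add: pos_def)
    qed
    moreover have "\<rho>' \<in> products k d A (d + 1 - (m + 1))" using \<rho>' by simp
    ultimately have "decoding k d A \<sigma> inp \<rho>' (m + 1) (pos p) s'"
      unfolding decoding_def P' using * p(3) m by (simp add: h_def n_def)
    then show "\<exists>\<rho>' c'. decoding k d A \<sigma> inp \<rho>' (m + 1) c' s'" by blast
  qed
qed

section \<open>Correctness and total cost of the decoder\<close>

lemma decoder_runs: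
  assumes k: "k \<ge> 2" and d: "d \<ge> 1" and w: "8 * (k * d) + 16 \<le> w"
    and A: "\<forall>a\<in>A. a permutes {1..k + 1} \<and> resolvable (k + 1) a"
    and \<tau>: "\<tau> \<in> sym_grp (k * d)" and \<sigma>: "\<sigma> \<in> products k d A d"
    and near: "\<And>j. j \<in> {1..k * d} \<Longrightarrow> \<bar>int (\<sigma> j) - int (\<tau> j)\<bar> \<le> int ((d - 1) div 2)"
  shows "runs w decoder (decoder_input k d \<tau>) (3000 * (k * d))
    (\<lambda>s. decoder_output (k * d) s = \<sigma>)"
proof -
  define inp where "inp = (\<lambda>j. if j \<in> {1..k*d} then \<tau> j else 0)"
  have inp: "inp j \<le> k * d" "j > k * d \<Longrightarrow> inp j = 0" for j
    using \<tau> permutes_in_image[of \<tau> "{1..k*d}" j] by (auto simp: inp_def sym_grp_def)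
  have near': "\<bar>int (\<sigma> j) - int (inp j)\<bar> \<le> int ((d - 1) div 2)" if "j \<in> {1..k * d}" for j
    using near[OF that] that by (simp add: inp_def)
  have kd: "k \<le> k * d" "d \<le> k * d" using k d by auto
  let ?I = "\<lambda>s. \<exists>\<rho> m c. decoding k d A \<sigma> inp \<rho> m c s"
  let ?b = "Less (Reg Rm) (Add (Reg Rd) (Lit 1))"
  let ?init = "Seq (Assign Rh (Quot (Sub (Reg Rd) (Lit 1)) (Lit 2)))
         (Seq (Assign Rm (Lit 1)) (Assign Rc (Lit 1)))"
  have "(d - 1) div 2 \<le> d" "d - 1 \<le> d" by linarith+
  then have "(d - 1) div 2 \<le> w" "d - 1 \<le> w" "d \<le> w" "2 \<le> w" "1 \<le> w"
    using w kd d by linarith+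
  \<comment> \<open>At the start no factor has been removed, so \<open>\<rho>\<close> is
    \<open>\<sigma>\<close> and the carried position is \<open>1\<close>.\<close>
  then have "wp w ?init (decoder_input k d \<tau>) (\<lambda>s. decoding k d A \<sigma> inp \<sigma> 1 1 s)"
    using d \<sigma> by (simp add: decoder_input_def decoding_def inp_def)
  from runs_wp[OF this]
  have "runs w decoder (decoder_input k d \<tau>) (max_cost ?init + (d + 1) * (1000 * k + bcost ?b + 1))
      (\<lambda>s. ?I s \<and> \<not> bval ?b s)"
    unfolding decoder_def
  proof (rule runs_Seq)
    fix s assume s: "decoding k d A \<sigma> inp \<sigma> 1 1 s"
    show "runs w (While ?b decode_block) s ((d + 1) * (1000 * k + bcost ?b + 1)) (\<lambda>s. ?I s \<and> \<not> bval ?b s)"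
    proof (rule runs_While[where \<mu> = "\<lambda>s. d + 1 - regs s Rm"])
      show "bfits w ?b s" if "?I s" for s
      proof -
        from that have "regs s Rd = d" "regs s Rm \<le> d + 1" by (auto simp: decoding_def)
        moreover from this have "regs s Rm \<le> w" "d + 1 \<le> w" "d \<le> w" "1 \<le> w"
          using w kd by linarith+
        ultimately show ?thesis by simp
      qed
      fix s assume "?I s" and b: "bval ?b s"
      then obtain \<rho> m c where s: "decoding k d A \<sigma> inp \<rho> m c s" by blast
      with b have m: "m \<le> d" "regs s Rm = m" by (auto simp: decoding_def)
      from decode_block_step[OF k d w A inp near' s m(1)]
      show "runs w decode_block s (1000 * k) (\<lambda>s'. ?I s' \<and> d + 1 - regs s' Rm < d + 1 - regs s Rm)"
      proof (rule runs_mono)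
        fix s' assume "\<exists>\<rho>' c'. decoding k d A \<sigma> inp \<rho>' (m + 1) c' s'"
        then show "?I s' \<and> d + 1 - regs s' Rm < d + 1 - regs s Rm"
          using m by (auto simp: decoding_def)
      qed auto
    next
      show "?I s" using s by blast
      show "d + 1 - regs s Rm \<le> d" using s by (simp add: decoding_def)
    qed
  qed
  then show ?thesis
  proof (rule runs_mono)
    \<comment> \<open>The guard and its branch cost 3 steps, and \<open>k \<ge> 2\<close> gives
      \<open>3 \<le> k + 1\<close>.\<close>
    have "max_cost ?init \<le> 6" "bcost ?b + 1 \<le> k + 1" using k by simp_all
    then have "max_cost ?init + (d + 1) * (1000 * k + bcost ?b + 1) \<le> 6 + (d + 1) * (1001 * k + 1)"
      by (intro add_mono mult_le_mono2) auto
    also have "\<dots> = 1001 * (k * d) + 1001 * k + d + 7" by (simp add: algebra_simps)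
    also have "\<dots> \<le> 3000 * (k * d)" using kd k d by linarith
    finally show "max_cost ?init + (d + 1) * (1000 * k + bcost ?b + 1) \<le> 3000 * (k * d)" .
    fix s assume "?I s \<and> \<not> bval ?b s"
    then obtain \<rho> m c where s: "decoding k d A \<sigma> inp \<rho> m c s" and b: "\<not> bval ?b s" by blast
    \<comment> \<open>Now \<open>c = k*d + 1\<close>, so no position of the vector is exempt from
      being right.\<close>
    have "m = d + 1" using s b by (auto simp: decoding_def)
    with s have "arrs s 1 j = \<sigma> j" if "j \<in> {1..k * d}" for j
      using that by (auto simp: decoding_def)
    moreover have "\<sigma> j = j" if "j \<notin> {1..k * d}" for j
      using that k A \<sigma> by (intro products_outside[of k A d d \<sigma> j]) auto
    ultimately show "decoder_output (k * d) s = \<sigma>"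
      by (auto simp: decoder_output_def fun_eq_iff)
  qed
qed

theorem mainTheorem5:
  fixes comp_code aux_code :: "nat \<Rightarrow> (nat \<Rightarrow> nat) list"
    and comp_trans aux_trans :: "nat \<Rightarrow> nat list"
  assumes "\<And>k. k \<ge> 2 \<Longrightarrow> complete_code k (comp_code k) (comp_trans k)"
    and "\<And>l. l \<ge> 3 \<Longrightarrow> auxiliary_code l (aux_code l) (aux_trans l)"
  shows "\<exists>decoder :: com. \<exists>b c :: nat. \<forall>k d n t :: nat. \<forall>C1 \<tau>.
           k \<ge> 2 \<longrightarrow> d \<ge> 1 \<longrightarrow> n = k * d \<longrightarrow>
           C1 = code_C1 k d (comp_trans k) (aux_trans (k + 1)) \<longrightarrow>
           t \<le> (d - 1) div 2 \<longrightarrow>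
           \<tau> \<in> sym_grp n \<longrightarrow> (\<exists>\<sigma>\<in>C1. d_inf n \<sigma> \<tau> \<le> int t) \<longrightarrow>
           (\<exists>T s. exec (n ^ b) decoder (decoder_input k d \<tau>) T s \<and>
                  T \<le> c * n \<and>
                  decoder_output n s \<in> C1 \<and>
                  d_inf n \<tau> (decoder_output n s) \<le> int t \<and>
                  (\<forall>\<sigma>\<in>C1. d_inf n \<sigma> \<tau> \<le> int t \<longrightarrow> decoder_output n s = \<sigma>))"
\<comment> \<open>The exponent 5 suffices because \<open>n \<ge> 2\<close> gives
  \<open>8 * n + 16 \<le> n * 2 ^ 4 \<le> n ^ 5\<close>; the factor 3000 comes from
  \<open>decoder_runs\<close>.\<close>
proof (rule exI[of _ decoder], rule exI[of _ 5], rule exI[of _ 3000], intro allI impI)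
  fix k d n t :: nat and C1 \<tau>
  assume k: "k \<ge> 2" and d: "d \<ge> 1" and n: "n = k * d"
    and C1: "C1 = code_C1 k d (comp_trans k) (aux_trans (k + 1))"
    and t: "t \<le> (d - 1) div 2" and \<tau>: "\<tau> \<in> sym_grp n" and ex: "\<exists>\<sigma>\<in>C1. d_inf n \<sigma> \<tau> \<le> int t"
  have aux: "auxiliary_code (k + 1) (aux_code (k + 1)) (aux_trans (k + 1))"
    using assms(2)[of "k + 1"] k by simp
  define A where "A = set (aux_code (k + 1))"
  have A: "\<forall>a\<in>A. a permutes {1..k + 1} \<and> resolvable (k + 1) a"
  proof
    fix a assume a: "a \<in> A"
    then have "resolvable (k + 1) a"
      using auxiliary_code_resolvable[OF aux] k by (simp add: A_def)
    moreover have "a permutes {1..k + 1}"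
      using aux a unfolding auxiliary_code_def G_aux_def G_up_def sym_grp_def A_def by blast
    ultimately show "a permutes {1..k + 1} \<and> resolvable (k + 1) a" by simp
  qed
  have "\<forall>r\<in>set (comp_trans k). 1 < r \<and> r \<le> k"
    using assms(1)[OF k] by (auto simp: complete_code_def transition_seq_def in_set_conv_nth)
  then have sub: "C1 \<subseteq> products k d A d"
    unfolding C1 A_def using aux d by (intro code_C1_subset_products)
  have "n \<ge> 2" using mult_le_mono[OF k d] by (simp add: n)
  then have "2 ^ 4 \<le> n ^ 4" by (rule power_mono) simp
  then have "n * 2 ^ 4 \<le> n * n ^ 4" by (rule mult_le_mono2)
  also have "n * n ^ 4 = n ^ Suc 4" by (rule power_Suc[symmetric])
  also have "Suc 4 = 5" by simp
  finally have "n * 2 ^ 4 \<le> n ^ 5" .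
  moreover have "8 * n + 16 \<le> n * 2 ^ 4" using \<open>n \<ge> 2\<close> by simp
  ultimately have w: "8 * (k * d) + 16 \<le> n ^ 5" unfolding n[symmetric] by (rule order_trans[rotated])
  have run: "runs (n ^ 5) decoder (decoder_input k d \<tau>) (3000 * n) (\<lambda>s. decoder_output n s = \<sigma>)"
    if \<sigma>: "\<sigma> \<in> C1" "d_inf n \<sigma> \<tau> \<le> int t" for \<sigma>
    unfolding n
  proof (rule decoder_runs[OF k d w[unfolded n] A])
    show "\<tau> \<in> sym_grp (k * d)" using \<tau> unfolding n .
    show "\<sigma> \<in> products k d A d" using \<sigma>(1) sub by (rule subsetD[rotated])
    fix j assume "j \<in> {1..k * d}"
    then have "\<bar>int (\<sigma> j) - int (\<tau> j)\<bar> \<le> d_inf n \<sigma> \<tau>"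
      unfolding d_inf_def n by (intro Max_ge) auto
    with \<sigma>(2) t show "\<bar>int (\<sigma> j) - int (\<tau> j)\<bar> \<le> int ((d - 1) div 2)" by linarith
  qed
  from ex obtain \<sigma> where \<sigma>: "\<sigma> \<in> C1" "d_inf n \<sigma> \<tau> \<le> int t" by blast
  from run[OF this] obtain T s where s: "exec (n ^ 5) decoder (decoder_input k d \<tau>) T s"
    "T \<le> 3000 * n" "decoder_output n s = \<sigma>"
    unfolding runs_def by blast
  \<comment> \<open>Runs for two close codewords start from the same input; by determinism they end
    in the same state, whose output equals both codewords.\<close>
  have unique: "decoder_output n s = \<sigma>'" if \<sigma>': "\<sigma>' \<in> C1" "d_inf n \<sigma>' \<tau> \<le> int t" for \<sigma>'
  proof -
    from run[OF \<sigma>'] obtain U u where u: "exec (n ^ 5) decoder (decoder_input k d \<tau>) U u"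
      "decoder_output n u = \<sigma>'"
      unfolding runs_def by blast
    from exec_deterministic[OF s(1) u(1)] have "u = s" by (rule conjunct2)
    with u(2) show ?thesis by (simp only:)
  qed
  have "d_inf n \<tau> \<sigma> = d_inf n \<sigma> \<tau>"
    unfolding d_inf_def by (subst abs_minus_commute) (rule refl)
  with \<sigma>(2) have near: "d_inf n \<tau> \<sigma> \<le> int t" by (simp only:)
  show "\<exists>T s. exec (n ^ 5) decoder (decoder_input k d \<tau>) T s \<and>
                  T \<le> 3000 * n \<and>
                  decoder_output n s \<in> C1 \<and>
                  d_inf n \<tau> (decoder_output n s) \<le> int t \<and>
                  (\<forall>\<sigma>\<in>C1. d_inf n \<sigma> \<tau> \<le> int t \<longrightarrow> decoder_output n s = \<sigma>)"
  proof (intro exI conjI ballI impI)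
    show "decoder_output n s \<in> C1" "d_inf n \<tau> (decoder_output n s) \<le> int t"
      unfolding s(3) by (rule \<sigma>(1), rule near)
  qed (fact s(1), fact s(2), erule (1) unique)
qed

end
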